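(* Let $b\ge2$ be an integer. For $\lambda>0$ and $\alpha\ge2$ let $\mathscr H_\lambda^\alpha(\phi)=\lambda|\phi|^\alpha$. There are constants $C,c>0$ depending only on $b$, and for each $\alpha_*\ge2$ a constant $D_{\alpha_*}>0$, such that for all $\alpha\in[2,\alpha_*]$, all $\lambda>0$, all integers $n\ge1$ and all $\tau_1,\tau_2\in[b]^n$, $$\Bigl|\mathcal M_{b,n}^{\mathscr H_\lambda^\alpha}\bigl[\phi_{\tau_1}\phi_{\tau_2}\bigr]\Bigr|\le C\exp\Bigl(-c\,\mathbf d(\tau_1,\tau_2)+C\Bigl(\lambda^{-\frac{\alpha-2}{\alpha^2}}+\frac1\alpha\log_+\frac1\lambda+D_{\alpha_*}\Bigr)\Bigr),$$ where $\log_+x=\max\{0,\log x\}$.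
   Context: $[b]=\{1,\dots,b\}$, and $\mathcal T_{b,n}=\bigcup_{k=0}^n[b]^k$ is the set of strings over $[b]$ of length at most $n$ ($[b]^0=\{\varnothing\}$). $|\tau|$ denotes the length of $\tau$; $\tau'\preceq\tau$ means $\tau'$ is a prefix of $\tau$ (possibly $\tau'=\tau$). Branching random walk (BRW): let $(\zeta_\tau)_{\tau\in\mathcal T_{b,n}\setminus\{\varnothing\}}$ be independent standard Gaussians and $\phi_\tau=\sum_{\varnothing\ne\tau'\preceq\tau}\zeta_{\tau'}$. Let $\mathcal M_{b,n}^0$ be the law on $\mathbb R^{[b]^n}$ of the endpoints $\Phi=(\phi_\tau)_{\tau\in[b]^n}$. Tilted measure: for a convex function $\mathscr H:\mathbb R\to\mathbb R\cup\{\infty\}$, $\mathcal M_{b,n}^{\mathscr H}$ is the probability measure on $\mathbb R^{[b]^n}$ with $\frac{d\mathcal M_{b,n}^{\mathscr H}}{d\mathcal M_{b,n}^0}(\Phi)\propto\exp\bigl(-\sum_{\tau\in[b]^n}\mathscr H(\phi_\tau)\bigr)$. The notation $\mathcal M_{b,n}^{\mathscr H}[F(\Phi)]$ denotes the expectation of $F(\Phi)$ for $\Phi\sim\mathcal M_{b,n}^{\mathscr H}$. Distance: for $\tau_1,\tau_2\in[b]^n$, $\mathbf d(\tau_1,\tau_2)=n-|\tau'|$ where $\tau'$ is the longest common prefix of $\tau_1$ and $\tau_2$. *)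

theory Defs
  imports "HOL-Probability.Probability" "HOL-Library.Sublist"
begin

definition words :: "nat \<Rightarrow> nat \<Rightarrow> nat list set" where
  "words b n = {\<tau>. length \<tau> = n \<and> set \<tau> \<subseteq> {1..b}}"

definition tree :: "nat \<Rightarrow> nat \<Rightarrow> nat list set" where
  "tree b n = (\<Union>k\<in>{0..n}. words b k)"

text \<open>The endpoint configurations, indexed by the strings of length \<open>n\<close>, are represented
  as extensional functions, i.e. as elements of the space of \<open>Pi\<^sub>M (words b n) (\<lambda>_. borel)\<close>.\<close>

definition brw_noise :: "nat \<Rightarrow> nat \<Rightarrow> (nat list \<Rightarrow> real) measure" where
  "brw_noise b n =
     Pi\<^sub>M (tree b n - {[]}) (\<lambda>_. density lborel (\<lambda>x. ennreal (std_normal_density x)))"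

definition brw_field :: "(nat list \<Rightarrow> real) \<Rightarrow> nat list \<Rightarrow> real" where
  "brw_field \<zeta> \<tau> = (\<Sum>\<tau>' | prefix \<tau>' \<tau> \<and> \<tau>' \<noteq> []. \<zeta> \<tau>')"

definition brw_law :: "nat \<Rightarrow> nat \<Rightarrow> (nat list \<Rightarrow> real) measure" where
  "brw_law b n = distr (brw_noise b n) (Pi\<^sub>M (words b n) (\<lambda>_. borel))
     (\<lambda>\<zeta>. \<lambda>\<tau>\<in>words b n. brw_field \<zeta> \<tau>)"

text \<open>\<open>exp (- x)\<close> with \<open>exp (- \<infinity>) = 0\<close>; the value at \<open>x = - \<infinity>\<close> is irrelevant, since
  potentials take values in the reals extended by \<open>\<infinity>\<close> only.\<close>

definition exp_neg :: "ereal \<Rightarrow> ennreal" where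
  "exp_neg x = (if x = \<infinity> then 0 else ennreal (exp (- real_of_ereal x)))"

definition gibbs_weight ::
    "nat \<Rightarrow> nat \<Rightarrow> (real \<Rightarrow> ereal) \<Rightarrow> (nat list \<Rightarrow> real) \<Rightarrow> ennreal" where
  "gibbs_weight b n H \<Phi> = exp_neg (\<Sum>\<tau>\<in>words b n. H (\<Phi> \<tau>))"

text \<open>Intended for convex potentials \<open>H\<close> that never take the value \<open>- \<infinity>\<close> and for which the
  normalising integral is positive and finite.\<close>

definition tilted_law :: "nat \<Rightarrow> nat \<Rightarrow> (real \<Rightarrow> ereal) \<Rightarrow> (nat list \<Rightarrow> real) measure" where
  "tilted_law b n H = density (brw_law b n)
     (\<lambda>\<Phi>. gibbs_weight b n H \<Phi> / (\<integral>\<^sup>+ \<Psi>. gibbs_weight b n H \<Psi> \<partial>brw_law b n))"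

definition power_potential :: "real \<Rightarrow> real \<Rightarrow> real \<Rightarrow> ereal" where
  "power_potential lam \<alpha> \<phi> = ereal (lam * \<bar>\<phi>\<bar> powr \<alpha>)"

definition tree_dist :: "nat \<Rightarrow> nat list \<Rightarrow> nat list \<Rightarrow> nat" where
  "tree_dist n \<tau>\<^sub>1 \<tau>\<^sub>2 = n - length (longest_common_prefix \<tau>\<^sub>1 \<tau>\<^sub>2)"

definition log_plus :: "real \<Rightarrow> real" where
  "log_plus x = max 0 (ln x)"


text \<open>The measures above are probability measures and the two-point functions exist, so that
  Bochner integrals against them carry their usual meaning.\<close>

lemma finite_words [simp]: "finite (words b n)"
proof -
  have "words b n = {xs. set xs \<subseteq> {1..b} \<and> length xs = n}"
    by (auto simp: words_def)
  then show ?thesis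
    by (simp add: finite_lists_length_eq)
qed

lemma finite_tree [simp]: "finite (tree b n)"
  by (simp add: tree_def)

lemma prefix_in_tree:
  assumes "\<tau> \<in> words b n" "prefix \<tau>' \<tau>"
  shows "\<tau>' \<in> tree b n"
proof -
  have "length \<tau>' \<le> n" "set \<tau>' \<subseteq> {1..b}"
    using assms by (auto simp: words_def prefix_length_le dest: set_mono_prefix)
  then show ?thesis
    by (auto simp: tree_def words_def)
qed

lemma finite_prefixes [simp]: "finite {\<tau>'. prefix \<tau>' \<tau> \<and> P \<tau>'}"
  by (rule finite_subset[of _ "set (prefixes \<tau>)"]) auto

lemma prob_space_brw_noise: "prob_space (brw_noise b n)"
  unfolding brw_noise_def
  by (intro prob_space_PiM prob_space_normal_density) simp

lemma measurable_brw_noise_component: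
  assumes "\<sigma> \<in> tree b n - {[]}"
  shows "(\<lambda>\<zeta>. \<zeta> \<sigma>) \<in> borel_measurable (brw_noise b n)"
proof -
  have "(\<lambda>\<zeta>. \<zeta> \<sigma>) \<in> measurable (brw_noise b n)
      (density lborel (\<lambda>x. ennreal (std_normal_density x)))"
    unfolding brw_noise_def by (rule measurable_component_singleton[OF assms])
  then show ?thesis
    by (simp cong: measurable_cong_sets)
qed

lemma measurable_brw_field:
  assumes "\<tau> \<in> words b n"
  shows "(\<lambda>\<zeta>. brw_field \<zeta> \<tau>) \<in> borel_measurable (brw_noise b n)"
  unfolding brw_field_def
  by (intro borel_measurable_sum measurable_brw_noise_component)
     (auto intro: prefix_in_tree[OF assms])

lemma measurable_brw_endpoints:
  "(\<lambda>\<zeta>. \<lambda>\<tau>\<in>words b n. brw_field \<zeta> \<tau>)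
     \<in> measurable (brw_noise b n) (Pi\<^sub>M (words b n) (\<lambda>_. borel))"
  by (intro measurable_restrict measurable_brw_field)

lemma prob_space_brw_law: "prob_space (brw_law b n)"
  unfolding brw_law_def
  by (rule prob_space.prob_space_distr[OF prob_space_brw_noise measurable_brw_endpoints])

lemma sets_brw_law [measurable_cong]:
  "sets (brw_law b n) = sets (Pi\<^sub>M (words b n) (\<lambda>_. borel))"
  by (simp add: brw_law_def)

lemma gibbs_weight_power_potential:
  "gibbs_weight b n (power_potential lam \<alpha>) \<Phi> =
     ennreal (exp (- (\<Sum>\<tau>\<in>words b n. lam * \<bar>\<Phi> \<tau>\<bar> powr \<alpha>)))"
  by (simp add: gibbs_weight_def exp_neg_def power_potential_def)

lemma measurable_gibbs_power [measurable]:
  "gibbs_weight b n (power_potential lam \<alpha>) \<in> borel_measurable (brw_law b n)"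
proof -
  have "(\<lambda>\<Phi>. exp (- (\<Sum>\<tau>\<in>words b n. lam * \<bar>\<Phi> \<tau>\<bar> powr \<alpha>))) \<in> borel_measurable (brw_law b n)"
    by measurable
  then show ?thesis
    by (simp add: gibbs_weight_power_potential[abs_def])
qed

lemma normaliser_power:
  assumes "lam > 0"
  shows "(\<integral>\<^sup>+ \<Psi>. gibbs_weight b n (power_potential lam \<alpha>) \<Psi> \<partial>brw_law b n) \<noteq> 0"
    and "(\<integral>\<^sup>+ \<Psi>. gibbs_weight b n (power_potential lam \<alpha>) \<Psi> \<partial>brw_law b n) \<noteq> \<infinity>"
proof -
  interpret prob_space "brw_law b n" by (rule prob_space_brw_law)
  let ?w = "gibbs_weight b n (power_potential lam \<alpha>)"
  have pos: "?w \<Psi> \<noteq> 0" and le: "?w \<Psi> \<le> 1" for \<Psi>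
    using assms by (auto simp: gibbs_weight_power_potential ennreal_eq_0_iff intro!: sum_nonneg)
  have "(\<integral>\<^sup>+ \<Psi>. ?w \<Psi> \<partial>brw_law b n) \<le> (\<integral>\<^sup>+ \<Psi>. 1 \<partial>brw_law b n)"
    by (rule nn_integral_mono) (use le in auto)
  then show "(\<integral>\<^sup>+ \<Psi>. ?w \<Psi> \<partial>brw_law b n) \<noteq> \<infinity>"
    by (auto simp: emeasure_space_1 top_unique)
  show "(\<integral>\<^sup>+ \<Psi>. ?w \<Psi> \<partial>brw_law b n) \<noteq> 0"
  proof
    assume "(\<integral>\<^sup>+ \<Psi>. ?w \<Psi> \<partial>brw_law b n) = 0"
    then have "AE \<Psi> in brw_law b n. ?w \<Psi> = 0"
      by (subst (asm) nn_integral_0_iff_AE) auto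
    then have "AE \<Psi> in brw_law b n. False"
      using pos by auto
    then show False
      by (simp add: AE_False)
  qed
qed

lemma prob_space_tilted_law:
  assumes "lam > 0"
  shows "prob_space (tilted_law b n (power_potential lam \<alpha>))"
proof
  let ?w = "gibbs_weight b n (power_potential lam \<alpha>)"
  let ?Z = "\<integral>\<^sup>+ \<Psi>. ?w \<Psi> \<partial>brw_law b n"
  have "emeasure (tilted_law b n (power_potential lam \<alpha>))
      (space (tilted_law b n (power_potential lam \<alpha>))) = (\<integral>\<^sup>+ \<Psi>. ?w \<Psi> / ?Z \<partial>brw_law b n)"
    unfolding tilted_law_def by (subst emeasure_density) (auto intro!: nn_integral_cong)
  also have "\<dots> = ?Z / ?Z"
    by (rule nn_integral_divide) measurable
  also have "\<dots> = 1"
    using normaliser_power[OF assms, of b n \<alpha>] by (simp add: ennreal_divide_self top.not_eq_extremum)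
  finally show "emeasure (tilted_law b n (power_potential lam \<alpha>))
      (space (tilted_law b n (power_potential lam \<alpha>))) = 1" .
qed

lemma integrable_brw_noise_square:
  assumes "\<sigma> \<in> tree b n - {[]}"
  shows "integrable (brw_noise b n) (\<lambda>\<zeta>. (\<zeta> \<sigma>)\<^sup>2)"
proof -
  let ?N = "density lborel (\<lambda>x. ennreal (std_normal_density x))"
  have N: "distr (brw_noise b n) ?N (\<lambda>\<zeta>. \<zeta> \<sigma>) = ?N"
    unfolding brw_noise_def
    by (rule distr_PiM_component) (use assms in \<open>auto intro: prob_space_normal_density\<close>)
  have "integrable ?N (\<lambda>x. x\<^sup>2)"
    by (subst integrable_density) (auto simp: integrable_std_normal_moment)
  then have "integrable (distr (brw_noise b n) ?N (\<lambda>\<zeta>. \<zeta> \<sigma>)) (\<lambda>x. x\<^sup>2)"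
    by (simp add: N)
  then show ?thesis
    by (rule integrable_distr[rotated])
       (use assms in \<open>simp add: brw_noise_def measurable_component_singleton\<close>)
qed

lemma integrable_brw_noise_product:
  assumes "\<sigma> \<in> tree b n - {[]}" "\<rho> \<in> tree b n - {[]}"
  shows "integrable (brw_noise b n) (\<lambda>\<zeta>. \<zeta> \<sigma> * \<zeta> \<rho>)"
proof (rule Bochner_Integration.integrable_bound)
  show "integrable (brw_noise b n) (\<lambda>\<zeta>. (\<zeta> \<sigma>)\<^sup>2 + (\<zeta> \<rho>)\<^sup>2)"
    using assms by (intro Bochner_Integration.integrable_add integrable_brw_noise_square)
  show "(\<lambda>\<zeta>. \<zeta> \<sigma> * \<zeta> \<rho>) \<in> borel_measurable (brw_noise b n)"
    using assms by (intro borel_measurable_times measurable_brw_noise_component)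
  have "\<bar>x * y\<bar> \<le> x\<^sup>2 + y\<^sup>2" for x y :: real
  proof -
    have "2 * \<bar>x * y\<bar> \<le> x\<^sup>2 + y\<^sup>2"
      using sum_squares_bound[of "\<bar>x\<bar>" "\<bar>y\<bar>"] by (simp add: abs_mult)
    then show ?thesis
      by linarith
  qed
  then show "AE \<zeta> in brw_noise b n. norm (\<zeta> \<sigma> * \<zeta> \<rho>) \<le> norm ((\<zeta> \<sigma>)\<^sup>2 + (\<zeta> \<rho>)\<^sup>2)"
    by simp
qed

lemma integrable_brw_law_product:
  assumes "\<tau>\<^sub>1 \<in> words b n" "\<tau>\<^sub>2 \<in> words b n"
  shows "integrable (brw_law b n) (\<lambda>\<Phi>. \<Phi> \<tau>\<^sub>1 * \<Phi> \<tau>\<^sub>2)"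
proof -
  have "integrable (brw_noise b n) (\<lambda>\<zeta>. brw_field \<zeta> \<tau>\<^sub>1 * brw_field \<zeta> \<tau>\<^sub>2)"
    unfolding brw_field_def sum_product
    by (intro Bochner_Integration.integrable_sum integrable_brw_noise_product)
       (auto intro: assms[THEN prefix_in_tree])
  then show ?thesis
    unfolding brw_law_def using assms
    by (subst integrable_distr_eq[OF measurable_brw_endpoints]) auto
qed

lemma integrable_tilted_law_product:
  assumes "lam > 0" "\<tau>\<^sub>1 \<in> words b n" "\<tau>\<^sub>2 \<in> words b n"
  shows "integrable (tilted_law b n (power_potential lam \<alpha>)) (\<lambda>\<Phi>. \<Phi> \<tau>\<^sub>1 * \<Phi> \<tau>\<^sub>2)"
proof -
  let ?e = "\<lambda>\<Phi>. exp (- (\<Sum>\<tau>\<in>words b n. lam * \<bar>\<Phi> \<tau>\<bar> powr \<alpha>))"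
  define Z where "Z = enn2real (\<integral>\<^sup>+ \<Psi>. gibbs_weight b n (power_potential lam \<alpha>) \<Psi> \<partial>brw_law b n)"
  have Z: "(\<integral>\<^sup>+ \<Psi>. gibbs_weight b n (power_potential lam \<alpha>) \<Psi> \<partial>brw_law b n) = ennreal Z" "Z > 0"
    using normaliser_power[OF assms(1), of b n \<alpha>]
    by (auto simp: Z_def less_top enn2real_positive_iff zero_less_iff_neq_zero)
  have eq: "tilted_law b n (power_potential lam \<alpha>) =
      density (brw_law b n) (\<lambda>\<Phi>. ennreal (?e \<Phi> / Z))"
    unfolding tilted_law_def Z(1) using Z(2)
    by (simp add: gibbs_weight_power_potential divide_ennreal)
  have int: "integrable (brw_law b n) (\<lambda>\<Phi>. \<Phi> \<tau>\<^sub>1 * \<Phi> \<tau>\<^sub>2)"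
    by (rule integrable_brw_law_product[OF assms(2,3)])
  have meas: "(\<lambda>\<Phi>. ?e \<Phi> / Z) \<in> borel_measurable (brw_law b n)"
    by measurable
  have "integrable (brw_law b n) (\<lambda>\<Phi>. (?e \<Phi> / Z) *\<^sub>R (\<Phi> \<tau>\<^sub>1 * \<Phi> \<tau>\<^sub>2))"
  proof (rule Bochner_Integration.integrable_bound)
    show "integrable (brw_law b n) (\<lambda>\<Phi>. (1 / Z) * (\<Phi> \<tau>\<^sub>1 * \<Phi> \<tau>\<^sub>2))"
      using int by (rule integrable_mult_right)
    show "(\<lambda>\<Phi>. (?e \<Phi> / Z) *\<^sub>R (\<Phi> \<tau>\<^sub>1 * \<Phi> \<tau>\<^sub>2)) \<in> borel_measurable (brw_law b n)"
      using meas borel_measurable_integrable[OF int] by (rule borel_measurable_scaleR)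
    have "?e \<Phi> / Z \<le> 1 / Z" for \<Phi> :: "nat list \<Rightarrow> real"
      using Z(2) assms(1) by (intro divide_right_mono) (auto intro!: sum_nonneg)
    then have "\<bar>?e \<Phi> / Z\<bar> * \<bar>x\<bar> \<le> \<bar>1 / Z\<bar> * \<bar>x\<bar>" for \<Phi> :: "nat list \<Rightarrow> real" and x
      using Z(2) by (intro mult_right_mono) auto
    then show "AE \<Phi> in brw_law b n.
        norm ((?e \<Phi> / Z) *\<^sub>R (\<Phi> \<tau>\<^sub>1 * \<Phi> \<tau>\<^sub>2)) \<le> norm ((1 / Z) * (\<Phi> \<tau>\<^sub>1 * \<Phi> \<tau>\<^sub>2))"
      by (auto simp only: real_norm_def real_scaleR_def abs_mult[of "_ / Z"] intro!: AE_I2)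
  qed
  then show ?thesis
    unfolding eq using Z(2) meas borel_measurable_integrable[OF int]
    by (subst integrable_density) auto
qed

end

theory Submission
  imports Defs "HOL-Real_Asymp.Real_Asymp"
begin

text \<open>Integrating out the leaves of the tree replaces the leaf weight \<open>f = exp (- H)\<close> by
  \<open>heat f ^ b\<close> and a factor \<open>h\<close> attached to a leaf by its conditional mean \<open>tilted_mean f h\<close> attached
  to the parent. If \<open>f\<close> is log-concave with constant \<open>\<kappa>\<close>, the conditional variance is at most
  \<open>1 / (1 + \<kappa>)\<close>; hence conditional means of Lipschitz functions contract by this factor, and the new
  weight has log-concavity constant \<open>b * \<kappa> / (1 + \<kappa>)\<close>, which grows geometrically until it exceeds
  \<open>1 / 2\<close>. The potential \<open>lam * \<bar>x\<bar> powr \<alpha>\<close> is not uniformly convex, but one averaging step makes it so,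
  with a constant proportional to \<open>min 1 lam\<close>. So all but the lowest \<open>O (log (1 / lam) + \<alpha>)\<close> levels contract
  by \<open>2 / 3\<close>, and odd observables at two leaves decorrelate exponentially in their distance. This number
  of levels is absorbed by the exponent of the theorem: by its term \<open>log_plus (1 / lam) / \<alpha>\<close> for
  \<open>\<alpha> \<le> 4\<close>, and by \<open>lam powr (- ((\<alpha> - 2) / \<alpha>\<^sup>2))\<close> for \<open>\<alpha> > 4\<close>.\<close>

section \<open>Gaussian averages of exponentially bounded functions\<close>

text \<open>The class contains the drifts of power potentials and is closed under sums, products and
  exponential tilts. All its members are integrable against Gaussian weights, so integrability
  reduces to closure rules.\<close>

definition exp_bounded :: "(real \<Rightarrow> real) \<Rightarrow> bool" where
  "exp_bounded h \<longleftrightarrow> h \<in> borel_measurable borel \<and> (\<exists>K a. \<forall>x. \<bar>h x\<bar> \<le> K * exp (a * \<bar>x\<bar>))"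

lemma exp_boundedI:
  assumes "h \<in> borel_measurable borel" "\<And>x. \<bar>h x\<bar> \<le> K * exp (a * \<bar>x\<bar>)"
  shows "exp_bounded h"
  using assms by (auto simp: exp_bounded_def)

lemma exp_bounded_measurable [measurable_dest]:
  "exp_bounded h \<Longrightarrow> h \<in> borel_measurable borel"
  by (simp add: exp_bounded_def)

lemma exp_bounded_obtain:
  assumes "exp_bounded h"
  obtains K a where "K \<ge> 0" "a \<ge> 0" "\<And>x. \<bar>h x\<bar> \<le> K * exp (a * \<bar>x\<bar>)"
proof -
  obtain K a where K: "\<And>x. \<bar>h x\<bar> \<le> K * exp (a * \<bar>x\<bar>)"
    using assms by (auto simp: exp_bounded_def)
  have "\<bar>h x\<bar> \<le> \<bar>K\<bar> * exp (\<bar>a\<bar> * \<bar>x\<bar>)" for x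
    by (rule order_trans[OF K]) (intro mult_mono, auto intro: mult_right_mono)
  with that[of "\<bar>K\<bar>" "\<bar>a\<bar>"] show thesis by simp
qed

lemma exp_bounded_mono:
  assumes "exp_bounded h" "g \<in> borel_measurable borel" "\<And>x. \<bar>g x\<bar> \<le> \<bar>h x\<bar>"
  shows "exp_bounded g"
  using assms unfolding exp_bounded_def by (meson order_trans)

lemma exp_bounded_const : "exp_bounded (\<lambda>x. c)"
  by (rule exp_boundedI[of _ "\<bar>c\<bar>" 0]) auto

lemma exp_bounded_id : "exp_bounded (\<lambda>x. x)"
proof (rule exp_boundedI[of _ 1 1])
  show "\<bar>x\<bar> \<le> 1 * exp (1 * \<bar>x\<bar>)" for x :: real
    using exp_ge_add_one_self[of "\<bar>x\<bar>"] unfolding mult_1 by linarith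
qed simp

lemma exp_bounded_exp : "exp_bounded (\<lambda>x. exp (c * x))"
  by (rule exp_boundedI[of _ 1 "\<bar>c\<bar>"]) (auto simp flip: abs_mult)

lemma exp_bounded_add:
  assumes "exp_bounded g" "exp_bounded h"
  shows "exp_bounded (\<lambda>x. g x + h x)"
proof -
  obtain K a where 1: "K \<ge> 0" "a \<ge> 0" "\<And>x. \<bar>g x\<bar> \<le> K * exp (a * \<bar>x\<bar>)"
    using exp_bounded_obtain[OF assms(1)] by blast
  obtain L c where 2: "L \<ge> 0" "c \<ge> 0" "\<And>x. \<bar>h x\<bar> \<le> L * exp (c * \<bar>x\<bar>)"
    using exp_bounded_obtain[OF assms(2)] by blast
  show ?thesis
  proof (rule exp_boundedI[of _ "K + L" "a + c"])
    show "(\<lambda>x. g x + h x) \<in> borel_measurable borel" using assms by measurable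
    fix x
    have "\<bar>g x + h x\<bar> \<le> K * exp (a * \<bar>x\<bar>) + L * exp (c * \<bar>x\<bar>)"
      using 1(3)[of x] 2(3)[of x] by linarith
    also have "\<dots> \<le> K * exp ((a + c) * \<bar>x\<bar>) + L * exp ((a + c) * \<bar>x\<bar>)"
      using 1 2 by (intro add_mono mult_left_mono) (auto intro!: mult_right_mono)
    finally show "\<bar>g x + h x\<bar> \<le> (K + L) * exp ((a + c) * \<bar>x\<bar>)" by (simp add: algebra_simps)
  qed
qed

lemma exp_bounded_mult:
  assumes "exp_bounded g" "exp_bounded h"
  shows "exp_bounded (\<lambda>x. g x * h x)"
proof -
  obtain K a where 1: "K \<ge> 0" "a \<ge> 0" "\<And>x. \<bar>g x\<bar> \<le> K * exp (a * \<bar>x\<bar>)"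
    using exp_bounded_obtain[OF assms(1)] by blast
  obtain L c where 2: "L \<ge> 0" "c \<ge> 0" "\<And>x. \<bar>h x\<bar> \<le> L * exp (c * \<bar>x\<bar>)"
    using exp_bounded_obtain[OF assms(2)] by blast
  show ?thesis
  proof (rule exp_boundedI[of _ "K * L" "a + c"])
    show "(\<lambda>x. g x * h x) \<in> borel_measurable borel" using assms by measurable
    fix x
    have "\<bar>g x * h x\<bar> \<le> (K * exp (a * \<bar>x\<bar>)) * (L * exp (c * \<bar>x\<bar>))"
      unfolding abs_mult using 1 2 by (intro mult_mono) auto
    then show "\<bar>g x * h x\<bar> \<le> K * L * exp ((a + c) * \<bar>x\<bar>)" by (simp add: algebra_simps exp_add)
  qed
qed

lemma exp_bounded_uminus: "exp_bounded h \<Longrightarrow> exp_bounded (\<lambda>x. - h x)"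
  using exp_bounded_mult[of "\<lambda>x. -1" h] exp_bounded_const[of "-1"] by simp

lemma exp_bounded_diff:
  "exp_bounded g \<Longrightarrow> exp_bounded h \<Longrightarrow> exp_bounded (\<lambda>x. g x - h x)"
  using exp_bounded_add[of g "\<lambda>x. - h x"] exp_bounded_uminus[of h] by simp

lemma exp_bounded_power2: "exp_bounded h \<Longrightarrow> exp_bounded (\<lambda>x. (h x)\<^sup>2)"
  by (simp add: power2_eq_square exp_bounded_mult)

lemma exp_bounded_abs:
  assumes "exp_bounded h" shows "exp_bounded (\<lambda>x. \<bar>h x\<bar>)"
  by (rule exp_bounded_mono[OF assms]) (use assms in auto)

lemmas exp_bounded_intros =
  exp_bounded_const exp_bounded_id exp_bounded_exp exp_bounded_add exp_bounded_mult
  exp_bounded_uminus exp_bounded_diff exp_bounded_power2 exp_bounded_abs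

lemma exp_mult_std_normal_density:
  "exp (c * y) * std_normal_density y = exp (c\<^sup>2 / 2) * normal_density c 1 y"
proof -
  have "exp (c * y) * exp (- y\<^sup>2 / 2) = exp (c\<^sup>2 / 2) * exp (- (y - c)\<^sup>2 / 2)"
    by (simp flip: exp_add add: power2_eq_square field_simps)
  then show ?thesis
    by (simp add: normal_density_def field_simps)
qed

lemma integrable_exp_bounded:
  assumes "exp_bounded h"
  shows "integrable lborel (\<lambda>y. h y * std_normal_density y)"
proof -
  obtain K a where K: "K \<ge> 0" "a \<ge> 0" "\<And>x. \<bar>h x\<bar> \<le> K * exp (a * \<bar>x\<bar>)"
    using exp_bounded_obtain[OF assms] by blast
  let ?g = std_normal_density
  \<comment> \<open>Completing the square turns \<open>exp (c * y)\<close> times the standard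
    density into a multiple of the normal density centred at \<open>c\<close>. The majorant then
    uses \<open>exp (a * \<bar>y\<bar>) \<le> exp (a * y) + exp (- a * y)\<close>.\<close>
  have int: "integrable lborel (\<lambda>y. exp (c * y) * ?g y)" for c
    unfolding exp_mult_std_normal_density by (intro integrable_mult_right integrable_normal_density) simp
  show ?thesis
  proof (rule Bochner_Integration.integrable_bound)
    show "integrable lborel (\<lambda>y. K * (exp (a * y) * ?g y + exp (- a * y) * ?g y))"
      using int[of a] int[of "- a"] by (intro integrable_mult_right Bochner_Integration.integrable_add) auto
    show "(\<lambda>y. h y * ?g y) \<in> borel_measurable lborel" using assms by measurable
    have "\<bar>h y\<bar> \<le> K * (exp (a * y) + exp (- a * y))" for y
    proof -
      have "\<bar>h y\<bar> \<le> K * exp (a * \<bar>y\<bar>)" by (rule K)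
      also have "exp (a * \<bar>y\<bar>) \<le> exp (a * y) + exp (- a * y)" by (cases "y \<ge> 0") auto
      finally show ?thesis using K(1) by (simp add: mult_left_mono)
    qed
    then have "\<bar>h y\<bar> * ?g y \<le> K * (exp (a * y) + exp (- a * y)) * ?g y" for y
      by (intro mult_right_mono) auto
    then show "AE y in lborel. norm (h y * ?g y) \<le> norm (K * (exp (a * y) * ?g y + exp (- a * y) * ?g y))"
      using K(1) by (auto simp: abs_mult algebra_simps)
  qed
qed

section \<open>Gaussian Laplace transforms and differentiation under the integral\<close>

text \<open>Up to the factor \<open>exp (- x\<^sup>2 / 2)\<close> this is the convolution of
  \<open>h\<close> with the standard Gaussian (\<open>heat_eq\<close>). The variable
  \<open>x\<close> enters only through the tilt \<open>exp (x * y)\<close>, so differentiation in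
  \<open>x\<close> multiplies \<open>h\<close> by \<open>y\<close> and requires no smoothness of
  \<open>h\<close>.\<close>

definition gauss_laplace :: "(real \<Rightarrow> real) \<Rightarrow> real \<Rightarrow> real" where
  "gauss_laplace h x = (\<integral>y. h y * exp (x * y) * std_normal_density y \<partial>lborel)"

lemma integrable_gauss_laplace:
  "exp_bounded h \<Longrightarrow> integrable lborel (\<lambda>y. h y * exp (x * y) * std_normal_density y)"
  by (intro integrable_exp_bounded exp_bounded_intros)

lemma gauss_laplace_add:
  assumes "exp_bounded g" "exp_bounded h"
  shows "gauss_laplace (\<lambda>y. g y + h y) x = gauss_laplace g x + gauss_laplace h x"
  using integrable_gauss_laplace[OF assms(1), of x] integrable_gauss_laplace[OF assms(2), of x]
  by (simp add: gauss_laplace_def algebra_simps)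

lemma gauss_laplace_cmult: "gauss_laplace (\<lambda>y. c * h y) x = c * gauss_laplace h x"
  by (simp add: gauss_laplace_def mult.assoc)

lemma gauss_laplace_mono:
  assumes "exp_bounded g" "exp_bounded h" "\<And>y. g y \<le> h y"
  shows "gauss_laplace g x \<le> gauss_laplace h x"
  unfolding gauss_laplace_def using assms
  by (intro integral_mono integrable_gauss_laplace mult_right_mono) auto

lemma gauss_laplace_reflect: "gauss_laplace (\<lambda>y. h (- y)) x = gauss_laplace h (- x)"
proof -
  have [simp]: "std_normal_density (- y) = std_normal_density y" for y
    by (simp add: std_normal_density_def)
  show ?thesis
    unfolding gauss_laplace_def
    using lborel_integral_real_affine[of "-1" "\<lambda>y. h (- y) * exp (x * y) * std_normal_density y" 0]
    by simp
qed

lemma gauss_laplace_pos: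
  assumes "exp_bounded h" "\<And>y. h y > 0"
  shows "gauss_laplace h x > 0"
proof -
  let ?q = "\<lambda>y. h y * exp (x * y) * std_normal_density y"
  have pos: "?q y > 0" for y
    using assms(2)[of y] by (simp add: normal_density_pos)
  have nn: "gauss_laplace h x \<ge> 0"
    unfolding gauss_laplace_def using pos by (intro integral_nonneg_AE) (auto simp: less_imp_le)
  have "gauss_laplace h x \<noteq> 0"
  proof
    assume "gauss_laplace h x = 0"
    then have "AE y in lborel. ?q y = 0"
      unfolding gauss_laplace_def using integrable_gauss_laplace[OF assms(1), of x] pos
      by (subst (asm) integral_nonneg_eq_0_iff_AE) (auto simp: less_imp_le)
    then have "AE y in (lborel :: real measure). False"
      using pos by (auto elim!: eventually_mono simp: less_le)
    then show False by (simp add: AE_iff_null null_sets_def)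
  qed
  with nn show ?thesis by simp
qed

lemma exp_second_order_bound: "\<bar>exp u - 1 - u\<bar> \<le> u\<^sup>2 * exp \<bar>u\<bar>" for u :: real
proof -
  obtain t where t: "\<bar>t\<bar> \<le> \<bar>u\<bar>" "exp u = (\<Sum>m<2. u ^ m / fact m) + exp t / fact 2 * u ^ 2"
    using Maclaurin_exp_le[of u 2] by blast
  then have "exp u - 1 - u = exp t / 2 * u\<^sup>2"
    by (simp add: numeral_2_eq_2)
  moreover have "exp t / 2 \<le> exp \<bar>u\<bar>"
  proof -
    have "exp t \<le> exp \<bar>u\<bar>" using t(1) by simp
    then show ?thesis using exp_gt_zero[of t] by linarith
  qed
  moreover from this have "exp t / 2 * u\<^sup>2 \<le> exp \<bar>u\<bar> * u\<^sup>2"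
    by (rule mult_right_mono) simp
  moreover have "exp t / 2 * u\<^sup>2 \<ge> 0" by simp
  ultimately have "\<bar>exp u - 1 - u\<bar> \<le> exp \<bar>u\<bar> * u\<^sup>2" by linarith
  then show ?thesis by (simp add: mult.commute)
qed

text \<open>The second-order remainder of \<open>exp (t * y)\<close> is integrated against the
  weight. This gives an error of at most \<open>C * t\<^sup>2\<close> for
  \<open>\<bar>t\<bar> \<le> 1\<close>, hence convergence of the difference quotient.\<close>

lemma has_derivative_gauss_laplace:
  assumes "exp_bounded h"
  shows "(gauss_laplace h has_real_derivative gauss_laplace (\<lambda>y. y * h y) x) (at x)"
proof -
  \<comment> \<open>For \<open>\<bar>t\<bar> \<le> 1\<close> the remainder is at most
    \<open>(t * y)\<^sup>2 * exp \<bar>y\<bar>\<close>. Replacing \<open>exp \<bar>y\<bar>\<close>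
    by the sum of the two exponentials keeps the majorant free of \<open>t\<close>.\<close>
  define C where "C = gauss_laplace (\<lambda>y. \<bar>h y\<bar> * y\<^sup>2 * (exp (1 * y) + exp ((-1) * y))) x"
  have eb: "exp_bounded (\<lambda>y. \<bar>h y\<bar> * y\<^sup>2 * (exp (1 * y) + exp ((-1) * y)))"
    by (intro exp_bounded_intros assms)
  have eb1: "exp_bounded (\<lambda>y. y * h y)" by (intro exp_bounded_intros assms)
  have bound: "\<bar>gauss_laplace h (x + t) - gauss_laplace h x - t * gauss_laplace (\<lambda>y. y * h y) x\<bar> \<le> C * t\<^sup>2"
    if "\<bar>t\<bar> \<le> 1" for t
  proof -
    have eq: "gauss_laplace h (x + t) - gauss_laplace h x - t * gauss_laplace (\<lambda>y. y * h y) x =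
      (\<integral>y. h y * exp (x * y) * std_normal_density y * (exp (t * y) - 1 - t * y) \<partial>lborel)"
    proof -
      have "(\<integral>y. h y * exp (x * y) * std_normal_density y * (exp (t * y) - 1 - t * y) \<partial>lborel) =
        (\<integral>y. (h y * exp ((x + t) * y) * std_normal_density y - h y * exp (x * y) * std_normal_density y)
           - t * (y * h y * exp (x * y) * std_normal_density y) \<partial>lborel)"
        by (intro Bochner_Integration.integral_cong) (auto simp: algebra_simps exp_add)
      also have "\<dots> = gauss_laplace h (x + t) - gauss_laplace h x - t * gauss_laplace (\<lambda>y. y * h y) x"
        unfolding gauss_laplace_def
        using integrable_gauss_laplace[OF assms, of "x + t"] integrable_gauss_laplace[OF assms, of x]
          integrable_gauss_laplace[OF eb1, of x]
        by (subst Bochner_Integration.integral_diff) auto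
      finally show ?thesis by simp
    qed
    have "\<bar>gauss_laplace h (x + t) - gauss_laplace h x - t * gauss_laplace (\<lambda>y. y * h y) x\<bar> \<le>
       (\<integral>y. t\<^sup>2 * (\<bar>h y\<bar> * y\<^sup>2 * (exp (1 * y) + exp ((-1) * y)) * exp (x * y) * std_normal_density y) \<partial>lborel)"
      unfolding eq
    proof (rule integral_abs_bound_integral)
      show "integrable lborel (\<lambda>y. t\<^sup>2 * (\<bar>h y\<bar> * y\<^sup>2 * (exp (1 * y) + exp ((-1) * y)) * exp (x * y) * std_normal_density y))"
        by (intro integrable_mult_right integrable_gauss_laplace eb)
      have "integrable lborel (\<lambda>y. (h y * exp (x * y) * (exp (t * y) - 1 - t * y)) * std_normal_density y)"
        by (intro integrable_exp_bounded exp_bounded_intros assms)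
      then show "integrable lborel (\<lambda>y. h y * exp (x * y) * std_normal_density y * (exp (t * y) - 1 - t * y))"
        by (simp add: mult_ac)
      fix y
      have "\<bar>exp (t * y) - 1 - t * y\<bar> \<le> (t * y)\<^sup>2 * exp \<bar>t * y\<bar>" by (rule exp_second_order_bound)
      also have "\<dots> \<le> (t * y)\<^sup>2 * (exp (1 * y) + exp ((-1) * y))"
      proof (intro mult_left_mono)
        have "\<bar>t * y\<bar> \<le> \<bar>y\<bar>" using that by (simp add: abs_mult mult_left_le_one_le)
        then have "exp \<bar>t * y\<bar> \<le> exp \<bar>y\<bar>" by simp
        also have "\<dots> \<le> exp (1 * y) + exp ((-1) * y)" by (cases "y \<ge> 0") auto
        finally show "exp \<bar>t * y\<bar> \<le> exp (1 * y) + exp ((-1) * y)" .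
      qed auto
      finally have "\<bar>h y\<bar> * exp (x * y) * std_normal_density y * \<bar>exp (t * y) - 1 - t * y\<bar> \<le>
          \<bar>h y\<bar> * exp (x * y) * std_normal_density y * ((t * y)\<^sup>2 * (exp (1 * y) + exp ((-1) * y)))"
        by (intro mult_left_mono) auto
      then show "\<bar>h y * exp (x * y) * std_normal_density y * (exp (t * y) - 1 - t * y)\<bar> \<le>
         t\<^sup>2 * (\<bar>h y\<bar> * y\<^sup>2 * (exp (1 * y) + exp ((-1) * y)) * exp (x * y) * std_normal_density y)"
        by (simp add: abs_mult power_mult_distrib mult_ac)
    qed
    then show ?thesis by (simp add: C_def gauss_laplace_def mult.commute)
  qed
  show ?thesis
    unfolding DERIV_def
  proof (rule LIM_I)
    fix r :: real assume "r > 0"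
    have "C \<ge> 0" using bound[of 1] by auto
    show "\<exists>d>0. \<forall>t. t \<noteq> 0 \<and> norm (t - 0) < d \<longrightarrow>
       norm ((gauss_laplace h (x + t) - gauss_laplace h x) / t - gauss_laplace (\<lambda>y. y * h y) x) < r"
    \<comment> \<open>The error of the difference quotient is at most
      \<open>C * \<bar>t\<bar>\<close>; \<open>C + 1\<close> in the denominator covers the case
      \<open>C = 0\<close>.\<close>
    proof (intro exI[of _ "min 1 (r / (C + 1))"] conjI allI impI)
      show "0 < min 1 (r / (C + 1))" using \<open>r > 0\<close> \<open>C \<ge> 0\<close> by simp
      fix t :: real assume t: "t \<noteq> 0 \<and> norm (t - 0) < min 1 (r / (C + 1))"
      have "(gauss_laplace h (x + t) - gauss_laplace h x) / t - gauss_laplace (\<lambda>y. y * h y) x =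
        (gauss_laplace h (x + t) - gauss_laplace h x - t * gauss_laplace (\<lambda>y. y * h y) x) / t"
        using t by (simp add: field_simps)
      then have "norm ((gauss_laplace h (x + t) - gauss_laplace h x) / t - gauss_laplace (\<lambda>y. y * h y) x) =
        \<bar>gauss_laplace h (x + t) - gauss_laplace h x - t * gauss_laplace (\<lambda>y. y * h y) x\<bar> / \<bar>t\<bar>"
        by simp
      also have "\<dots> \<le> C * t\<^sup>2 / \<bar>t\<bar>" using bound[of t] t by (intro divide_right_mono) auto
      also have "\<dots> = C * \<bar>t\<bar>" using t by (simp add: power2_eq_square field_simps flip: abs_mult)
      also have "\<dots> \<le> (C + 1) * \<bar>t\<bar>" by (simp add: mult_right_mono)
      also have "\<dots> < r" using t \<open>C \<ge> 0\<close> by (simp add: field_simps)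
      finally show "norm ((gauss_laplace h (x + t) - gauss_laplace h x) / t - gauss_laplace (\<lambda>y. y * h y) x) < r" .
    qed
  qed
qed

section \<open>One step of the Gaussian heat semigroup\<close>

definition std_normal :: "real measure" where
  "std_normal = density lborel (\<lambda>x. ennreal (std_normal_density x))"

lemma prob_space_std_normal: "prob_space std_normal"
  unfolding std_normal_def by (intro prob_space_normal_density) simp

definition heat :: "(real \<Rightarrow> real) \<Rightarrow> real \<Rightarrow> real" where
  "heat h x = (\<integral>z. h (x + z) \<partial>std_normal)"

lemma std_normal_density_shift:
  "std_normal_density (y - x) = exp (- x\<^sup>2 / 2) * (exp (x * y) * std_normal_density y)"
proof -
  have "exp (- (y - x)\<^sup>2 / 2) = exp (- x\<^sup>2 / 2) * (exp (x * y) * exp (- y\<^sup>2 / 2))"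
    by (simp flip: exp_add add: power2_eq_square field_simps)
  then show ?thesis by (simp add: std_normal_density_def)
qed

lemma heat_eq:
  assumes "h \<in> borel_measurable borel"
  shows "heat h x = exp (- x\<^sup>2 / 2) * gauss_laplace h x"
proof -
  have "heat h x = (\<integral>z. std_normal_density z * h (x + z) \<partial>lborel)"
    unfolding heat_def std_normal_def using assms by (subst integral_density) auto
  also have "\<dots> = (\<integral>y. std_normal_density (y - x) * h y \<partial>lborel)"
    using lborel_integral_real_affine[of 1 "\<lambda>y. std_normal_density (y - x) * h y" x] by simp
  also have "\<dots> = (\<integral>y. exp (- x\<^sup>2 / 2) * (h y * exp (x * y) * std_normal_density y) \<partial>lborel)"
    by (simp add: std_normal_density_shift mult_ac)
  finally show ?thesis by (simp add: gauss_laplace_def)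
qed

lemma integrable_heat:
  assumes "exp_bounded h"
  shows "integrable std_normal (\<lambda>z. h (x + z))"
proof -
  have "integrable lborel (\<lambda>y. exp (- x\<^sup>2 / 2) * (h y * exp (x * y) * std_normal_density y))"
    by (intro integrable_mult_right integrable_gauss_laplace assms)
  then have "integrable lborel (\<lambda>y. std_normal_density (y - x) * h y)"
    by (simp add: std_normal_density_shift mult_ac)
  then have "integrable lborel (\<lambda>z. std_normal_density z * h (x + z))"
    using lborel_integrable_real_affine[of "\<lambda>y. std_normal_density (y - x) * h y" 1 x] by simp
  moreover have "(\<lambda>z. h (x + z)) \<in> borel_measurable borel"
    using measurable_compose[OF _ exp_bounded_measurable[OF assms], of "\<lambda>z. x + z" borel] by simp
  ultimately show ?thesis
    unfolding std_normal_def by (subst integrable_density) auto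
qed

section \<open>Conditional means under log-concave weights\<close>

lemma integral_derivative_eq_0:
  fixes F f :: "real \<Rightarrow> real"
  assumes "\<And>x. (F has_real_derivative f x) (at x)" "continuous_on UNIV f" "integrable lborel f"
    and "(F \<longlongrightarrow> 0) at_top" "(F \<longlongrightarrow> 0) at_bot"
  shows "integral\<^sup>L lborel f = 0"
proof -
  have "(LBINT x=-\<infinity>..\<infinity>. f x) = 0 - 0"
  proof (rule interval_integral_FTC_integrable)
    show "(F has_vector_derivative f x) (at x)" for x
      using assms(1) by (simp add: has_real_derivative_iff_has_vector_derivative)
    show "isCont f x" for x
      using assms(2) by (simp add: continuous_on_eq_continuous_at)
    show "set_integrable lborel (einterval (-\<infinity>) \<infinity>) f"
      using assms(3) by (simp add: set_integrable_def)
    show "((F \<circ> real_of_ereal) \<longlongrightarrow> 0) (at_right (-\<infinity>))"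
      using assms(5) by (simp add: ereal_tendsto_simps)
    show "((F \<circ> real_of_ereal) \<longlongrightarrow> 0) (at_left \<infinity>)"
      using assms(4) by (simp add: ereal_tendsto_simps)
  qed simp
  then show ?thesis
    by (simp add: interval_lebesgue_integral_def set_lebesgue_integral_def)
qed

lemma exp_bounded_std_normal_density_tendsto_0:
  assumes "exp_bounded h"
  shows "((\<lambda>y. h y * std_normal_density y) \<longlongrightarrow> 0) at_top"
    and "((\<lambda>y. h y * std_normal_density y) \<longlongrightarrow> 0) at_bot"
proof -
  obtain K a where K: "K \<ge> 0" "a \<ge> 0" "\<And>x. \<bar>h x\<bar> \<le> K * exp (a * \<bar>x\<bar>)"
    using exp_bounded_obtain[OF assms] by blast
  \<comment> \<open>Completing the square in \<open>\<bar>y\<bar>\<close>: the growth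
    \<open>exp (a * \<bar>y\<bar>)\<close> only shifts the centre of the Gaussian to
    \<open>a\<close>.\<close>
  let ?B = "\<lambda>y. K * exp (a\<^sup>2 / 2) / sqrt (2 * pi) * exp (- (\<bar>y\<bar> - a)\<^sup>2 / 2)"
  have bd: "norm (h y * std_normal_density y) \<le> ?B y" for y
  proof -
    have "norm (h y * std_normal_density y) \<le> K * exp (a * \<bar>y\<bar>) * std_normal_density y"
      using K(3)[of y] by (simp add: abs_mult mult_right_mono)
    also have "\<dots> = K * (exp (a * \<bar>y\<bar>) * std_normal_density \<bar>y\<bar>)"
      by (simp add: std_normal_density_def)
    also have "\<dots> = ?B y"
      unfolding exp_mult_std_normal_density by (simp add: normal_density_def)
    finally show ?thesis .
  qed
  have g: "((\<lambda>y::real. exp (- y\<^sup>2 / 2)) \<longlongrightarrow> 0) at_top"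
    by real_asymp
  have lim: "(?B \<longlongrightarrow> 0) F" if F: "filterlim abs at_top F" for F
  proof (rule tendsto_mult_right_zero)
    have "filterlim (\<lambda>y. - a + \<bar>y\<bar>) at_top F"
      by (rule filterlim_tendsto_add_at_top[OF tendsto_const F])
    then have "filterlim (\<lambda>y. \<bar>y\<bar> - a) at_top F" by (simp add: add.commute)
    from filterlim_compose[OF g this]
    show "((\<lambda>y. exp (- (\<bar>y\<bar> - a)\<^sup>2 / 2)) \<longlongrightarrow> 0) F" .
  qed
  show "((\<lambda>y. h y * std_normal_density y) \<longlongrightarrow> 0) at_top"
    by (rule Lim_null_comparison[OF always_eventually[OF allI[OF bd]] lim[OF filterlim_abs_real]])
  have "filterlim (abs :: real \<Rightarrow> real) at_top at_bot"
    using filterlim_abs_real by (simp add: filterlim_at_bot_mirror)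
  then show "((\<lambda>y. h y * std_normal_density y) \<longlongrightarrow> 0) at_bot"
    by (rule Lim_null_comparison[OF always_eventually[OF allI[OF bd]] lim])
qed

lemma has_derivative_std_normal_density:
  "(std_normal_density has_real_derivative - y * std_normal_density y) (at y)"
proof -
  define c where "c = 1 / sqrt (2 * pi)"
  have eq: "std_normal_density = (\<lambda>y. c * exp (- y\<^sup>2 / 2))"
    by (simp add: fun_eq_iff std_normal_density_def c_def)
  show ?thesis
    unfolding eq by (auto intro!: derivative_eq_intros)
qed

text \<open>The conditional mean of \<open>h\<close> at a leaf given the value \<open>x\<close> of
  its parent: the conditional density of the leaf is proportional to
  \<open>f y * exp (- (y - x)\<^sup>2 / 2)\<close>, and the factor
  \<open>exp (- x\<^sup>2 / 2)\<close> cancels in the quotient.\<close>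

definition tilted_mean :: "(real \<Rightarrow> real) \<Rightarrow> (real \<Rightarrow> real) \<Rightarrow> real \<Rightarrow> real" where
  "tilted_mean f h x = gauss_laplace (\<lambda>y. f y * h y) x / gauss_laplace f x"

text \<open>Here \<open>f = exp (- V)\<close> and \<open>v = V'\<close> for a convex potential \<open>V\<close>. The slack \<open>s\<close> allows \<open>V\<close> to be
  flat on scales below \<open>sqrt s\<close>, as \<open>lam * \<bar>x\<bar> powr \<alpha>\<close> is at the origin; \<open>s = 0\<close> is uniform convexity
  with constant \<open>\<kappa>\<close>.\<close>

locale convex_weight =
  fixes f v :: "real \<Rightarrow> real" and \<kappa> s :: real
  assumes f_pos: "f x > 0"
    and f_le_1: "f x \<le> 1"
    and f_even: "f (- x) = f x"
    and f_deriv: "(f has_real_derivative - v x * f x) (at x)"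
    and v_cont: "continuous_on UNIV v"
    and v_exp_bounded: "exp_bounded v"
    and \<kappa>_nonneg: "\<kappa> \<ge> 0"
    and s_ge_0: "s \<ge> 0"
    and s_le_1: "s \<le> 1"
    and v_mono: "\<kappa> * ((x - y)\<^sup>2 - s) \<le> (x - y) * (v x - v y)"
begin

lemma f_cont: "continuous_on UNIV f"
  by (intro continuous_at_imp_continuous_on ballI DERIV_isCont[OF f_deriv])

lemma f_exp_bounded: "exp_bounded f"
proof (rule exp_boundedI[of _ 1 0])
  show "f \<in> borel_measurable borel"
    using f_cont by (rule borel_measurable_continuous_onI)
  show "\<bar>f x\<bar> \<le> 1 * exp (0 * \<bar>x\<bar>)" for x
    using f_pos[of x] f_le_1[of x] by simp
qed

lemmas eb_intros = exp_bounded_intros f_exp_bounded v_exp_bounded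

lemma laplace_f_pos: "gauss_laplace f x > 0"
  by (rule gauss_laplace_pos[OF f_exp_bounded f_pos])

abbreviation "mean \<equiv> tilted_mean f"

lemma mean_add:
  assumes "exp_bounded g" "exp_bounded h"
  shows "mean (\<lambda>y. g y + h y) x = mean g x + mean h x"
  unfolding tilted_mean_def using assms
  by (simp add: distrib_left gauss_laplace_add exp_bounded_mult f_exp_bounded add_divide_distrib)

lemma mean_cmult: "mean (\<lambda>y. c * h y) x = c * mean h x"
proof -
  have "(\<lambda>y. f y * (c * h y)) = (\<lambda>y. c * (f y * h y))" by (simp add: mult.left_commute)
  then show ?thesis unfolding tilted_mean_def by (simp only: gauss_laplace_cmult times_divide_eq_right)
qed

lemma mean_const: "mean (\<lambda>y. c) x = c"
proof -
  have "(\<lambda>y. f y * c) = (\<lambda>y. c * f y)" by (simp add: mult.commute)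
  then show ?thesis
    using laplace_f_pos[of x] by (simp only: tilted_mean_def gauss_laplace_cmult) simp
qed

lemma mean_diff:
  assumes "exp_bounded g" "exp_bounded h"
  shows "mean (\<lambda>y. g y - h y) x = mean g x - mean h x"
  using mean_add[OF assms(1) exp_bounded_uminus[OF assms(2)], of x] mean_cmult[of "-1" h x] by simp

lemma mean_mono:
  assumes "exp_bounded g" "exp_bounded h" "\<And>y. g y \<le> h y"
  shows "mean g x \<le> mean h x"
  unfolding tilted_mean_def using assms f_pos[THEN less_imp_le] laplace_f_pos[of x]
  by (intro divide_right_mono gauss_laplace_mono exp_bounded_mult f_exp_bounded mult_left_mono) auto

lemma mean_reflect: "mean (\<lambda>y. h (- y)) x = mean h (- x)"
proof -
  have "gauss_laplace f (- x) = gauss_laplace f x"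
    using gauss_laplace_reflect[of f "- x"] by (simp add: f_even)
  moreover have "gauss_laplace (\<lambda>y. f y * h y) (- x) = gauss_laplace (\<lambda>y. f y * h (- y)) x"
    using gauss_laplace_reflect[of "\<lambda>y. f y * h y" x] by (simp add: f_even)
  ultimately show ?thesis by (simp only: tilted_mean_def)
qed

text \<open>Evenness of \<open>f\<close> makes averaging commute with reflection. Oddness thus
  survives every level, so the observable keeps vanishing at the root value
  \<open>0\<close>.\<close>

lemma mean_odd:
  assumes "\<And>y. h (- y) = - h y"
  shows "mean h (- x) = - mean h x"
  using mean_reflect[of h x] mean_cmult[of "-1" h x] by (simp add: assms)

text \<open>The tilted density has logarithmic derivative \<open>- (v y + y - x)\<close>. The
  identity states that the integral of the derivative of \<open>y - m\<close> times this density
  vanishes; the Gaussian factor kills the boundary terms.\<close>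

lemma laplace_by_parts:
  "gauss_laplace (\<lambda>y. f y * ((y - m) * (v y + y - x))) x = gauss_laplace f x"
proof -
  define F where "F y = ((y - m) * f y * exp (x * y)) * std_normal_density y" for y
  define q where "q y = (f y - f y * ((y - m) * (v y + y - x))) * exp (x * y) * std_normal_density y" for y
  have eb: "exp_bounded (\<lambda>y. f y * ((y - m) * (v y + y - x)))"
    by (intro eb_intros)
  have "integral\<^sup>L lborel q = 0"
  proof (rule integral_derivative_eq_0[of F])
    show "(F has_real_derivative q y) (at y)" for y
      unfolding F_def q_def
      by (auto intro!: derivative_eq_intros has_derivative_std_normal_density f_deriv simp: algebra_simps)
    have "continuous_on UNIV std_normal_density"
      by (intro continuous_at_imp_continuous_on ballI DERIV_isCont[OF has_derivative_std_normal_density])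
    then show "continuous_on UNIV q"
      unfolding q_def using v_cont f_cont by (intro continuous_intros) auto
    show "integrable lborel q"
      unfolding q_def by (intro integrable_gauss_laplace eb_intros)
    have "exp_bounded (\<lambda>y. (y - m) * f y * exp (x * y))"
      by (intro eb_intros)
    then show "(F \<longlongrightarrow> 0) at_top" "(F \<longlongrightarrow> 0) at_bot"
      unfolding F_def by (auto intro: exp_bounded_std_normal_density_tendsto_0)
  qed
  also have "integral\<^sup>L lborel q = gauss_laplace (\<lambda>y. f y - f y * ((y - m) * (v y + y - x))) x"
    unfolding q_def gauss_laplace_def ..
  also have "\<dots> = gauss_laplace f x - gauss_laplace (\<lambda>y. f y * ((y - m) * (v y + y - x))) x"
    using gauss_laplace_add[OF f_exp_bounded exp_bounded_uminus[OF eb], of x]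
      gauss_laplace_cmult[of "-1" _ x] by simp
  finally show ?thesis by simp
qed

section \<open>Variance bounds and contraction of conditional means\<close>

text \<open>The bound on the conditional variance and the contraction factor of one averaging step;
  for \<open>s = 0\<close> it is the Brascamp-Lieb constant
  \<open>1 / (1 + \<kappa>)\<close>.\<close>

definition \<rho> :: real where "\<rho> = (1 + \<kappa> * s) / (1 + \<kappa>)"

lemma rho_pos: "\<rho> > 0" and rho_le_1: "\<rho> \<le> 1"
  using \<kappa>_nonneg s_ge_0 s_le_1
  by (auto simp: \<rho>_def field_simps mult_left_le intro!: divide_pos_pos add_pos_nonneg)

abbreviation "bary \<equiv> mean (\<lambda>y. y)"

definition "spread x = mean (\<lambda>y. (y - bary x)\<^sup>2) x"

lemma mean_centered: "mean (\<lambda>y. y - bary x) x = 0"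
  by (simp add: mean_diff mean_const exp_bounded_const exp_bounded_id)

text \<open>By parts, the covariance of \<open>y\<close> and \<open>v y + y\<close> is \<open>1\<close>, and \<open>v_mono\<close> bounds the covariance
  of \<open>y\<close> and \<open>v y\<close> from below: a one-dimensional Brascamp-Lieb inequality.\<close>

lemma spread_le: "spread x \<le> \<rho>"
proof -
  let ?m = "bary x"
  let ?d = "\<lambda>y. y - ?m"
  have eb: "exp_bounded ?d" "exp_bounded (\<lambda>y. (?d y)\<^sup>2)"
    "exp_bounded (\<lambda>y. ?d y * (v y - v ?m))"
    by (intro eb_intros)+
  have "mean (\<lambda>y. ?d y * (v y + y - x)) x = 1"
    using laplace_by_parts[of ?m x] laplace_f_pos[of x] by (simp add: tilted_mean_def)
  also have "(\<lambda>y. ?d y * (v y + y - x)) =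
     (\<lambda>y. (?d y * (v y - v ?m) + (?d y)\<^sup>2) + (v ?m + ?m - x) * ?d y)"
    by (auto simp: algebra_simps power2_eq_square)
  also have "mean \<dots> x = mean (\<lambda>y. ?d y * (v y - v ?m)) x + spread x"
    by (simp add: mean_add eb exp_bounded_intros mean_cmult mean_centered spread_def del: distrib_left)
  finally have *: "mean (\<lambda>y. ?d y * (v y - v ?m)) x + spread x = 1" .
  have "mean (\<lambda>y. \<kappa> * ((?d y)\<^sup>2 - s)) x \<le> mean (\<lambda>y. ?d y * (v y - v ?m)) x"
    by (intro mean_mono v_mono eb_intros)
  then have "\<kappa> * (spread x - s) \<le> mean (\<lambda>y. ?d y * (v y - v ?m)) x"
    by (simp only: mean_cmult mean_diff mean_const spread_def eb exp_bounded_const)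
  with * have "(1 + \<kappa>) * spread x \<le> 1 + \<kappa> * s" by (simp add: algebra_simps)
  then show ?thesis using \<kappa>_nonneg by (simp add: \<rho>_def field_simps)
qed

text \<open>Differentiating the tilt yields the conditional covariance of \<open>y\<close> and
  \<open>h y\<close>. Since \<open>y - bary x\<close> has mean zero, any constant \<open>c\<close>
  may be subtracted from \<open>h\<close>; it is left free so that it can be chosen as the value of
  \<open>h\<close> at the barycentre.\<close>

lemma has_derivative_mean:
  assumes "exp_bounded h"
  shows "(mean h has_real_derivative mean (\<lambda>y. (y - bary x) * (h y - c)) x) (at x)"
proof -
  let ?m = "bary x"
  have eb: "exp_bounded (\<lambda>y. f y * h y)" by (intro eb_intros assms)
  have swap: "(\<lambda>y. y * (f y * h y)) = (\<lambda>y. f y * (y * h y))" "(\<lambda>y. y * f y) = (\<lambda>y. f y * y)"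
    by (simp_all add: ac_simps)
  have "(mean h has_real_derivative
     (gauss_laplace (\<lambda>y. y * (f y * h y)) x * gauss_laplace f x -
      gauss_laplace (\<lambda>y. f y * h y) x * gauss_laplace (\<lambda>y. y * f y) x) / (gauss_laplace f x)\<^sup>2) (at x)"
    unfolding tilted_mean_def[abs_def]
    using laplace_f_pos[of x]
    by (auto intro!: derivative_eq_intros has_derivative_gauss_laplace eb f_exp_bounded
        simp: power2_eq_square)
  also have "(gauss_laplace (\<lambda>y. y * (f y * h y)) x * gauss_laplace f x -
      gauss_laplace (\<lambda>y. f y * h y) x * gauss_laplace (\<lambda>y. y * f y) x) / (gauss_laplace f x)\<^sup>2 =
      mean (\<lambda>y. y * h y) x - ?m * mean h x"
    using laplace_f_pos[of x]
    by (simp add: tilted_mean_def swap diff_divide_distrib power2_eq_square)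
  also have "\<dots> = mean (\<lambda>y. (y * h y - ?m * h y) - c * (y - ?m)) x"
    by (simp only: mean_diff mean_cmult mean_centered exp_bounded_intros assms)
  also have "(\<lambda>y. (y * h y - ?m * h y) - c * (y - ?m)) = (\<lambda>y. (y - ?m) * (h y - c))"
    by (auto simp: algebra_simps)
  finally show ?thesis .
qed

lemma has_derivative_bary: "(bary has_real_derivative spread x) (at x)"
  using has_derivative_mean[OF exp_bounded_id, of x "bary x"] by (simp add: spread_def power2_eq_square)

text \<open>With \<open>c = h (bary x)\<close> the integrand of the covariance is bounded by
  \<open>L * (y - bary x)\<^sup>2\<close>. The derivative of the mean is therefore at most
  \<open>L\<close> times the conditional variance.\<close>

lemma mean_lipschitz:
  assumes "exp_bounded h" "L \<ge> 0" "\<And>x y. \<bar>h x - h y\<bar> \<le> L * \<bar>x - y\<bar>"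
  shows "\<bar>mean h x - mean h y\<bar> \<le> L * \<rho> * \<bar>x - y\<bar>"
proof -
  let ?D = "\<lambda>x. mean (\<lambda>y. (y - bary x) * (h y - h (bary x))) x"
  have D: "\<bar>?D z\<bar> \<le> L * \<rho>" for z
  proof -
    let ?p = "\<lambda>y. (y - bary z) * (h y - h (bary z))"
    have eb: "exp_bounded ?p" by (intro eb_intros assms)
    have bd: "\<bar>?p y\<bar> \<le> L * (y - bary z)\<^sup>2" for y
    proof -
      have "\<bar>?p y\<bar> \<le> \<bar>y - bary z\<bar> * (L * \<bar>y - bary z\<bar>)"
        unfolding abs_mult by (intro mult_left_mono assms) auto
      also have "\<dots> = L * (y - bary z)\<^sup>2" by (simp add: power2_eq_square flip: abs_mult)
      finally show ?thesis .
    qed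
    have eq: "mean (\<lambda>y. L * (y - bary z)\<^sup>2) z = L * spread z"
      "mean (\<lambda>y. - (L * (y - bary z)\<^sup>2)) z = - (L * spread z)"
      using mean_cmult[of "-1"] by (simp_all add: mean_cmult spread_def)
    have eb2: "exp_bounded (\<lambda>y. L * (y - bary z)\<^sup>2)" by (intro eb_intros)
    have "?D z \<le> L * spread z"
      unfolding eq(1)[symmetric] using bd by (intro mean_mono eb eb2) (auto simp: abs_le_iff)
    moreover have "- (L * spread z) \<le> ?D z"
      unfolding eq(2)[symmetric] using bd
      by (intro mean_mono eb exp_bounded_uminus eb2) (auto simp: abs_le_iff minus_le_iff)
    moreover have "L * spread z \<le> L * \<rho>" using spread_le assms(2) by (rule mult_left_mono)
    ultimately show ?thesis by linarith
  qed
  show ?thesis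
    using field_differentiable_bound[of UNIV "mean h" ?D "L * \<rho>" x y]
      has_derivative_mean[OF assms(1)] D by simp
qed

lemma bary_0: "bary 0 = 0"
  using mean_odd[of "\<lambda>y. y" 0] by simp

lemma abs_bary_le: "\<bar>bary x\<bar> \<le> \<rho> * \<bar>x\<bar>"
  using mean_lipschitz[OF exp_bounded_id, of 1 x 0] by (simp add: bary_0)

text \<open>Second moment equals variance plus squared mean. The variance is bounded crudely by
  \<open>1\<close>; the mean contracts because \<open>bary\<close> vanishes at
  \<open>0\<close>.\<close>

lemma mean_square_le: "mean (\<lambda>y. y\<^sup>2) x \<le> 1 + \<rho>\<^sup>2 * x\<^sup>2"
proof -
  let ?m = "bary x"
  have "mean (\<lambda>y. y\<^sup>2) x = mean (\<lambda>y. ((y - ?m)\<^sup>2 + (2 * ?m) * (y - ?m)) + ?m\<^sup>2) x"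
    by (intro arg_cong[where f = "\<lambda>h. mean h x"] ext) (simp add: power2_eq_square algebra_simps)
  also have "\<dots> = spread x + ?m\<^sup>2"
    by (simp only: mean_add mean_cmult mean_centered mean_const exp_bounded_intros spread_def)
  also have "\<dots> \<le> 1 + (\<rho> * x)\<^sup>2"
  proof (rule add_mono)
    show "?m\<^sup>2 \<le> (\<rho> * x)\<^sup>2"
      using abs_bary_le[of x] rho_pos by (simp add: abs_le_square_iff[symmetric] abs_mult)
  qed (use spread_le[of x] rho_le_1 in linarith)
  finally show ?thesis by (simp add: power_mult_distrib)
qed

section \<open>The weight passed on to the parents\<close>

lemma heat_mult: "exp_bounded h \<Longrightarrow> heat (\<lambda>y. f y * h y) x = heat f x * mean h x"
  using laplace_f_pos[of x] f_exp_bounded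
  by (simp add: heat_eq tilted_mean_def exp_bounded_measurable exp_bounded_mult)

lemma heat_f_eq: "heat f x = exp (- x\<^sup>2 / 2) * gauss_laplace f x"
  by (rule heat_eq) (rule exp_bounded_measurable[OF f_exp_bounded])

lemma heat_f_pos: "heat f x > 0"
  using laplace_f_pos[of x] by (simp add: heat_f_eq)

lemma heat_f_le_1: "heat f x \<le> 1"
proof -
  note P = prob_space_std_normal
  have "heat f x \<le> (\<integral>z. 1 \<partial>std_normal)"
    unfolding heat_def using f_le_1 P
    by (intro integral_mono integrable_heat f_exp_bounded) (auto intro: finite_measure.integrable_const prob_space.finite_measure exp_bounded_const)
  then show ?thesis using prob_space.prob_space[OF P] by simp
qed

lemma has_derivative_heat_f: "(heat f has_real_derivative - (x - bary x) * heat f x) (at x)"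
proof -
  have "((\<lambda>x. exp (- x\<^sup>2 / 2) * gauss_laplace f x) has_real_derivative
      - x * exp (- x\<^sup>2 / 2) * gauss_laplace f x + exp (- x\<^sup>2 / 2) * gauss_laplace (\<lambda>y. y * f y) x) (at x)"
    by (auto intro!: derivative_eq_intros has_derivative_gauss_laplace f_exp_bounded)
  also have "- x * exp (- x\<^sup>2 / 2) * gauss_laplace f x + exp (- x\<^sup>2 / 2) * gauss_laplace (\<lambda>y. y * f y) x =
      - (x - bary x) * heat f x"
    using laplace_f_pos[of x] by (simp add: heat_f_eq tilted_mean_def field_simps)
  finally show ?thesis by (simp add: heat_f_eq[abs_def])
qed

text \<open>The negative logarithmic derivative of \<open>heat f\<close> is
  \<open>x - bary x\<close>, and \<open>bary\<close> is Lipschitz with constant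
  \<open>\<rho>\<close>. Hence the new drift has slope at least \<open>1 - \<rho>\<close> for each
  of the \<open>b\<close> children. This bound holds at all scales, so a single averaging step
  removes the slack.\<close>

lemma convex_weight_heat_power:
  assumes "b \<ge> (1 :: nat)"
  shows "convex_weight (\<lambda>x. heat f x ^ b) (\<lambda>x. b * (x - bary x)) (b * (\<kappa> * (1 - s) / (1 + \<kappa>))) 0"
proof
  show "heat f x ^ b > 0" for x by (simp add: heat_f_pos)
  show "heat f x ^ b \<le> 1" for x by (intro power_le_one heat_f_le_1 less_imp_le heat_f_pos)
  show "heat f (- x) ^ b = heat f x ^ b" for x
    using gauss_laplace_reflect[of f "- x"] by (simp add: heat_f_eq f_even)
  show "((\<lambda>x. heat f x ^ b) has_real_derivative - (b * (x - bary x)) * heat f x ^ b) (at x)" for x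
  proof -
    have "((\<lambda>x. heat f x ^ b) has_real_derivative b * heat f x ^ (b - 1) * (- (x - bary x) * heat f x)) (at x)"
      by (auto intro!: derivative_eq_intros has_derivative_heat_f)
    moreover have "heat f x ^ b = heat f x ^ (b - 1) * heat f x"
      using assms by (cases b) auto
    ultimately show ?thesis by (simp add: algebra_simps)
  qed
  have cont: "continuous_on UNIV bary"
    by (intro continuous_at_imp_continuous_on ballI DERIV_isCont[OF has_derivative_bary])
  then show "continuous_on UNIV (\<lambda>x. b * (x - bary x))"
    by (intro continuous_intros)
  have "exp_bounded bary"
  proof (rule exp_bounded_mono[OF exp_bounded_id])
    show "\<bar>bary x\<bar> \<le> \<bar>x\<bar>" for x
      using abs_bary_le[of x] rho_le_1 mult_right_mono[of \<rho> 1 "\<bar>x\<bar>"] by simp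
  qed (use cont in \<open>rule borel_measurable_continuous_onI\<close>)
  then show "exp_bounded (\<lambda>x. b * (x - bary x))" by (intro exp_bounded_intros)
  show "0 \<le> b * (\<kappa> * (1 - s) / (1 + \<kappa>))"
    using \<kappa>_nonneg s_le_1 by simp
  fix x y
  have "\<bar>(x - y) * (bary x - bary y)\<bar> \<le> \<bar>x - y\<bar> * (\<rho> * \<bar>x - y\<bar>)"
    unfolding abs_mult using mean_lipschitz[OF exp_bounded_id, of 1 x y] by (intro mult_left_mono) auto
  also have "\<dots> = \<rho> * (x - y)\<^sup>2" by (simp add: power2_eq_square flip: abs_mult)
  finally have "(1 - \<rho>) * (x - y)\<^sup>2 \<le> (x - y) * ((x - bary x) - (y - bary y))"
    by (simp add: algebra_simps power2_eq_square)
  moreover have "1 - \<rho> = \<kappa> * (1 - s) / (1 + \<kappa>)"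
    using \<kappa>_nonneg by (simp add: \<rho>_def field_simps)
  ultimately have "b * (\<kappa> * (1 - s) / (1 + \<kappa>) * (x - y)\<^sup>2) \<le> b * ((x - y) * ((x - bary x) - (y - bary y)))"
    by (intro mult_left_mono) auto
  then show "b * (\<kappa> * (1 - s) / (1 + \<kappa>)) * ((x - y)\<^sup>2 - 0) \<le> (x - y) * (b * (x - bary x) - b * (y - bary y))"
    by (simp add: algebra_simps)
qed auto

end

section \<open>Integrating out the leaves\<close>

lemma brw_noise_eq: "brw_noise b n = Pi\<^sub>M (tree b n - {[]}) (\<lambda>_. std_normal)"
  by (simp add: brw_noise_def std_normal_def)

lemma words_0 [simp]: "words b 0 = {[]}"
  by (auto simp: words_def)

lemma brw_field_Nil [simp]: "brw_field \<zeta> [] = 0"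
  by (simp add: brw_field_def)

lemma words_Suc: "words b (Suc n) = (\<lambda>(\<sigma>, i). \<sigma> @ [i]) ` (words b n \<times> {1..b})"
proof (intro equalityI subsetI)
  fix \<tau> assume "\<tau> \<in> words b (Suc n)"
  then have \<tau>: "length \<tau> = Suc n" "set \<tau> \<subseteq> {1..b}" by (auto simp: words_def)
  then obtain \<sigma> i where "\<tau> = \<sigma> @ [i]" by (metis length_Suc_conv_rev)
  with \<tau> show "\<tau> \<in> (\<lambda>(\<sigma>, i). \<sigma> @ [i]) ` (words b n \<times> {1..b})"
    by (auto simp: words_def)
qed (auto simp: words_def)

lemma butlast_in_words: "\<tau> \<in> words b (Suc n) \<Longrightarrow> butlast \<tau> \<in> words b n"
  by (auto simp: words_Suc)

lemma prod_words_Suc: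
  "(\<Prod>\<tau>\<in>words b (Suc n). g (butlast \<tau>)) = (\<Prod>\<sigma>\<in>words b n. g \<sigma> ^ b)"
proof -
  have "inj_on (\<lambda>(\<sigma>, i). \<sigma> @ [i]) (words b n \<times> {1..b})" by (auto simp: inj_on_def)
  then have "(\<Prod>\<tau>\<in>words b (Suc n). g (butlast \<tau>)) = (\<Prod>(\<sigma>, i)\<in>words b n \<times> {1..b}. g \<sigma>)"
    unfolding words_Suc by (subst prod.reindex) (auto intro!: prod.cong)
  also have "\<dots> = (\<Prod>\<sigma>\<in>words b n. \<Prod>i\<in>{1..b}. g \<sigma>)"
    by (subst prod.cartesian_product) simp
  finally show ?thesis by simp
qed

lemma tree_Suc: "tree b (Suc n) - {[]} = (tree b n - {[]}) \<union> words b (Suc n)"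
  by (auto simp: tree_def words_def le_Suc_eq)

lemma tree_disjoint_words: "(tree b n - {[]}) \<inter> words b (Suc n) = {}"
  by (auto simp: tree_def words_def)

text \<open>Separates the increment of the last level from the noise above it, which prepares Fubini
  on the product of the two noise spaces.\<close>

lemma brw_field_merge:
  assumes "\<tau> \<in> words b (Suc n)"
  shows "brw_field (merge (tree b n - {[]}) (words b (Suc n)) (\<zeta>, \<xi>)) \<tau> = brw_field \<zeta> (butlast \<tau>) + \<xi> \<tau>"
proof -
  let ?m = "merge (tree b n - {[]}) (words b (Suc n)) (\<zeta>, \<xi>)"
  have "\<tau> \<noteq> []" using assms by (auto simp: words_def)
  then have \<tau>: "butlast \<tau> @ [last \<tau>] = \<tau>" by simp
  have pre: "{\<tau>'. prefix \<tau>' \<tau> \<and> \<tau>' \<noteq> []} = insert \<tau> {\<tau>'. prefix \<tau>' (butlast \<tau>) \<and> \<tau>' \<noteq> []}"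
    using prefix_snoc[of _ "butlast \<tau>" "last \<tau>"] \<open>\<tau> \<noteq> []\<close> unfolding \<tau> by auto
  have nin: "\<tau> \<notin> {\<tau>'. prefix \<tau>' (butlast \<tau>) \<and> \<tau>' \<noteq> []}"
    using \<open>\<tau> \<noteq> []\<close> prefix_length_le[of \<tau> "butlast \<tau>"] by (auto simp flip: length_greater_0_conv)
  have "\<tau> \<notin> tree b n - {[]}" using assms tree_disjoint_words[of b n] by auto
  then have "?m \<tau> = \<xi> \<tau>" using assms by (auto simp: merge_def)
  moreover have "?m \<tau>' = \<zeta> \<tau>'" if "\<tau>' \<in> {\<tau>'. prefix \<tau>' (butlast \<tau>) \<and> \<tau>' \<noteq> []}" for \<tau>'
    using that prefix_in_tree[OF butlast_in_words[OF assms]] by (auto simp: merge_def)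
  ultimately show ?thesis
    unfolding brw_field_def pre using nin by (subst sum.insert) auto
qed

lemmas measure_space_brw_noise [simp] = prob_space.prob_space[OF prob_space_brw_noise]

text \<open>Given the noise on the upper levels, the leaf increments are independent. The inner
  integral therefore factorises into one heat average per leaf, evaluated at the field of its
  parent.\<close>

lemma brw_noise_integrate_leaves:
  fixes F :: "nat list \<Rightarrow> real \<Rightarrow> real"
  assumes "\<And>\<tau>. exp_bounded (F \<tau>)"
    and "integrable (brw_noise b (Suc n)) (\<lambda>\<zeta>. \<Prod>\<tau>\<in>words b (Suc n). F \<tau> (brw_field \<zeta> \<tau>))"
  shows "(\<integral>\<zeta>. (\<Prod>\<tau>\<in>words b (Suc n). F \<tau> (brw_field \<zeta> \<tau>)) \<partial>brw_noise b (Suc n)) =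
    (\<integral>\<zeta>. (\<Prod>\<tau>\<in>words b (Suc n). heat (F \<tau>) (brw_field \<zeta> (butlast \<tau>))) \<partial>brw_noise b n)"
proof -
  interpret std_normal: prob_space std_normal by (rule prob_space_std_normal)
  interpret product_sigma_finite "\<lambda>_ :: nat list. std_normal" ..
  let ?I = "tree b n - {[]}" and ?J = "words b (Suc n)"
  have "(\<integral>\<zeta>. (\<Prod>\<tau>\<in>?J. F \<tau> (brw_field \<zeta> \<tau>)) \<partial>brw_noise b (Suc n)) =
    (\<integral>\<zeta>. (\<integral>\<xi>. (\<Prod>\<tau>\<in>?J. F \<tau> (brw_field (merge ?I ?J (\<zeta>, \<xi>)) \<tau>)) \<partial>Pi\<^sub>M ?J (\<lambda>_. std_normal)) \<partial>brw_noise b n)"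
    unfolding brw_noise_eq tree_Suc
    using assms(2) unfolding brw_noise_eq tree_Suc
    by (intro product_integral_fold tree_disjoint_words) auto
  also have "\<dots> = (\<integral>\<zeta>. (\<integral>\<xi>. (\<Prod>\<tau>\<in>?J. F \<tau> (brw_field \<zeta> (butlast \<tau>) + \<xi> \<tau>)) \<partial>Pi\<^sub>M ?J (\<lambda>_. std_normal)) \<partial>brw_noise b n)"
    by (simp add: brw_field_merge cong: prod.cong)
  also have "\<dots> = (\<integral>\<zeta>. (\<Prod>\<tau>\<in>?J. heat (F \<tau>) (brw_field \<zeta> (butlast \<tau>))) \<partial>brw_noise b n)"
    unfolding heat_def
    by (intro Bochner_Integration.integral_cong refl product_integral_prod integrable_heat assms) auto
  finally show ?thesis .
qed

lemma integrable_brw_field_product: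
  assumes "\<tau>\<^sub>1 \<in> words b n" "\<tau>\<^sub>2 \<in> words b n"
  shows "integrable (brw_noise b n) (\<lambda>\<zeta>. brw_field \<zeta> \<tau>\<^sub>1 * brw_field \<zeta> \<tau>\<^sub>2)"
  unfolding brw_field_def sum_product
  by (intro Bochner_Integration.integrable_sum integrable_brw_noise_product)
     (auto intro: assms[THEN prefix_in_tree])

lemma measurable_brw_field_comp:
  assumes "\<tau> \<in> words b n" "h \<in> borel_measurable borel"
  shows "(\<lambda>\<zeta>. h (brw_field \<zeta> \<tau>)) \<in> borel_measurable (brw_noise b n)"
  using measurable_compose[OF measurable_brw_field assms(2)] assms(1) by auto

text \<open>Distinct words of equal length differ at some position, so their common prefix is proper
  and cannot reach the last letter.\<close>

lemma longest_common_prefix_butlast: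
  "length xs = length ys \<Longrightarrow> xs \<noteq> ys \<Longrightarrow>
    longest_common_prefix (butlast xs) (butlast ys) = longest_common_prefix xs ys"
  by (induction xs ys rule: list_induct2) auto

lemma tree_dist_same [simp]: "\<tau> \<in> words b n \<Longrightarrow> tree_dist n \<tau> \<tau> = 0"
proof -
  have "longest_common_prefix \<tau> \<tau> = \<tau>" by (induction \<tau>) auto
  then show "\<tau> \<in> words b n \<Longrightarrow> ?thesis" by (simp add: tree_dist_def words_def)
qed

lemma tree_dist_Suc:
  assumes "\<tau>\<^sub>1 \<in> words b (Suc n)" "\<tau>\<^sub>2 \<in> words b (Suc n)" "\<tau>\<^sub>1 \<noteq> \<tau>\<^sub>2"
  shows "tree_dist (Suc n) \<tau>\<^sub>1 \<tau>\<^sub>2 = Suc (tree_dist n (butlast \<tau>\<^sub>1) (butlast \<tau>\<^sub>2))"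
proof -
  have "longest_common_prefix (butlast \<tau>\<^sub>1) (butlast \<tau>\<^sub>2) = longest_common_prefix \<tau>\<^sub>1 \<tau>\<^sub>2"
    using assms by (intro longest_common_prefix_butlast) (auto simp: words_def)
  moreover have "length (longest_common_prefix (butlast \<tau>\<^sub>1) (butlast \<tau>\<^sub>2)) \<le> n"
    using prefix_length_le[OF longest_common_prefix_prefix1[of "butlast \<tau>\<^sub>1" "butlast \<tau>\<^sub>2"]] assms(1)
    by (auto simp: words_def)
  ultimately show ?thesis by (simp add: tree_dist_def Suc_diff_le)
qed

context convex_weight
begin

lemma prod_f_bounds: "0 < (\<Prod>\<tau>\<in>A. f (g \<tau>))" "(\<Prod>\<tau>\<in>A. f (g \<tau>)) \<le> 1"
  by (intro prod_pos f_pos ballI) (intro prod_le_1 conjI f_le_1 less_imp_le f_pos)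

lemma integrable_prod_f_mult:
  assumes "integrable (brw_noise b n) g"
  shows "integrable (brw_noise b n) (\<lambda>\<zeta>. (\<Prod>\<tau>\<in>words b n. f (brw_field \<zeta> \<tau>)) * g \<zeta>)"
proof (rule Bochner_Integration.integrable_bound[OF assms])
  show "(\<lambda>\<zeta>. (\<Prod>\<tau>\<in>words b n. f (brw_field \<zeta> \<tau>)) * g \<zeta>) \<in> borel_measurable (brw_noise b n)"
    using assms
    by (intro borel_measurable_times borel_measurable_prod measurable_brw_field_comp
        exp_bounded_measurable f_exp_bounded borel_measurable_integrable)
  show "AE \<zeta> in brw_noise b n. norm ((\<Prod>\<tau>\<in>words b n. f (brw_field \<zeta> \<tau>)) * g \<zeta>) \<le> norm (g \<zeta>)"
    unfolding real_norm_def abs_mult abs_of_pos[OF prod_f_bounds(1)]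
    by (intro AE_I2 mult_left_le_one_le abs_ge_zero prod_f_bounds less_imp_le[OF prod_f_bounds(1)])
qed

text \<open>\<open>S\<close> is the set of leaves carrying an observable; it is applied with zero,
  one and two leaves. The product on the right stays indexed by \<open>S\<close> because two marked
  leaves may share a parent, whose factor then occurs twice.\<close>

lemma brw_integrate_marked_leaves:
  assumes "S \<subseteq> words b (Suc n)" "exp_bounded h"
    and "integrable (brw_noise b (Suc n)) (\<lambda>\<zeta>. \<Prod>\<tau>\<in>S. h (brw_field \<zeta> \<tau>))"
  shows "(\<integral>\<zeta>. (\<Prod>\<tau>\<in>words b (Suc n). f (brw_field \<zeta> \<tau>)) * (\<Prod>\<tau>\<in>S. h (brw_field \<zeta> \<tau>)) \<partial>brw_noise b (Suc n)) =
    (\<integral>\<zeta>. (\<Prod>\<sigma>\<in>words b n. heat f (brw_field \<zeta> \<sigma>) ^ b) * (\<Prod>\<tau>\<in>S. mean h (brw_field \<zeta> (butlast \<tau>))) \<partial>brw_noise b n)"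
proof -
  define F where "F \<tau> x = f x * (if \<tau> \<in> S then h x else 1)" for \<tau> x
  have mark: "(\<Prod>\<tau>\<in>words b (Suc n). if \<tau> \<in> S then g \<tau> else 1) = (\<Prod>\<tau>\<in>S. g \<tau>)" for g :: "nat list \<Rightarrow> real"
    using assms(1) by (simp add: prod.inter_restrict[symmetric] Int_absorb1)
  have F: "(\<Prod>\<tau>\<in>words b (Suc n). F \<tau> (brw_field \<zeta> \<tau>)) =
      (\<Prod>\<tau>\<in>words b (Suc n). f (brw_field \<zeta> \<tau>)) * (\<Prod>\<tau>\<in>S. h (brw_field \<zeta> \<tau>))" for \<zeta>
    by (simp add: F_def prod.distrib mark)
  have eb: "exp_bounded (F \<tau>)" for \<tau>
    using assms(2) unfolding F_def[abs_def] by (cases "\<tau> \<in> S") (auto intro: eb_intros)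
  have heatF: "heat (F \<tau>) x = heat f x * (if \<tau> \<in> S then mean h x else 1)" for \<tau> x
    using heat_mult[OF assms(2), of x] by (simp add: F_def[abs_def])
  have int: "integrable (brw_noise b (Suc n)) (\<lambda>\<zeta>. \<Prod>\<tau>\<in>words b (Suc n). F \<tau> (brw_field \<zeta> \<tau>))"
    unfolding F by (rule integrable_prod_f_mult[OF assms(3)])
  have "(\<Prod>\<tau>\<in>words b (Suc n). heat (F \<tau>) (brw_field \<zeta> (butlast \<tau>))) =
      (\<Prod>\<sigma>\<in>words b n. heat f (brw_field \<zeta> \<sigma>) ^ b) * (\<Prod>\<tau>\<in>S. mean h (brw_field \<zeta> (butlast \<tau>)))" for \<zeta>
    using prod_words_Suc[of "\<lambda>\<sigma>. heat f (brw_field \<zeta> \<sigma>)" b n]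
    by (simp add: heatF prod.distrib mark)
  then show ?thesis
    using brw_noise_integrate_leaves[OF eb int] by (simp add: F)
qed

text \<open>Measurability comes from differentiability in \<open>x\<close>; only a growth bound
  remains to be supplied.\<close>

lemma exp_bounded_mean:
  assumes "exp_bounded h" "exp_bounded g" "\<And>x. \<bar>mean h x\<bar> \<le> g x"
  shows "exp_bounded (mean h)"
proof (rule exp_bounded_mono[OF assms(2)])
  have "continuous_on UNIV (mean h)"
    by (intro continuous_at_imp_continuous_on ballI DERIV_isCont[OF has_derivative_mean[OF assms(1)]])
  then show "mean h \<in> borel_measurable borel" by (rule borel_measurable_continuous_onI)
qed (use assms(3) in \<open>meson abs_ge_self order_trans\<close>)

end

section \<open>Induction over the levels of the tree\<close>

text \<open>The index \<open>k\<close> counts the levels already integrated out, starting from the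
  leaves. From level \<open>k0\<close> on, each averaging step contracts by at least
  \<open>2 / 3\<close>.\<close>

locale weight_flow =
  fixes b :: nat and f v :: "nat \<Rightarrow> real \<Rightarrow> real" and \<kappa> s :: "nat \<Rightarrow> real" and k0 :: nat
  assumes weight: "convex_weight (f k) (v k) (\<kappa> k) (s k)"
    and f_Suc: "f (Suc k) = (\<lambda>x. heat (f k) x ^ b)"
    and contracting: "k \<ge> k0 \<Longrightarrow> convex_weight.\<rho> (\<kappa> k) (s k) \<le> 2 / 3"
begin

text \<open>Integrating out all \<open>n\<close> levels leaves the weight with index
  \<open>n + k\<close> at the root, where the field is \<open>0\<close>.\<close>

lemma partition_function:
  "(\<integral>\<zeta>. (\<Prod>\<sigma>\<in>words b n. f k (brw_field \<zeta> \<sigma>)) \<partial>brw_noise b n) = f (n + k) 0"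
proof (induction n arbitrary: k)
  case (Suc n)
  interpret convex_weight "f k" "v k" "\<kappa> k" "s k" by (rule weight)
  \<comment> \<open>The leaf integration is applied with no marked leaf; the empty product is the
    constant \<open>1\<close>.\<close>
  have "integrable (brw_noise b (Suc n)) (\<lambda>\<zeta>. \<Prod>\<tau>\<in>{}. 1 :: real)"
    using prob_space.finite_measure[OF prob_space_brw_noise] by (simp add: finite_measure.integrable_const)
  from brw_integrate_marked_leaves[OF _ exp_bounded_const this]
  show ?case using Suc.IH[of "Suc k"] by (simp add: f_Suc)
qed simp

text \<open>One averaging step turns the growth bound \<open>p + q * x\<^sup>2\<close> into
  \<open>(p + q) + (q * \<rho>\<^sup>2) * x\<^sup>2\<close>. The quantity
  \<open>p + q * (2 + real (k0 - k))\<close> does not increase under this step and dominates the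
  value at the root. Linear growth in the number of non-contracting levels is all that is
  lost.\<close>

lemma one_point_bound:
  assumes "exp_bounded h" "p \<ge> 0" "q \<ge> 0" "\<And>x. \<bar>h x\<bar> \<le> p + q * x\<^sup>2" "\<tau> \<in> words b n"
  shows "\<bar>\<integral>\<zeta>. (\<Prod>\<sigma>\<in>words b n. f k (brw_field \<zeta> \<sigma>)) * h (brw_field \<zeta> \<tau>) \<partial>brw_noise b n\<bar>
    \<le> f (n + k) 0 * (p + q * (2 + real (k0 - k)))"
  using assms
proof (induction n arbitrary: k h p q \<tau>)
  case 0
  interpret convex_weight "f k" "v k" "\<kappa> k" "s k" by (rule weight)
  have "\<bar>h 0\<bar> \<le> p + q * (2 + real (k0 - k))"
  proof -
    have "0 \<le> q * (2 + real (k0 - k))" using 0(3) by simp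
    with 0(4)[of 0] show ?thesis by simp
  qed
  then show ?case
    using 0(5) f_pos[of 0] by (simp add: abs_mult mult_left_mono)
next
  case (Suc n)
  interpret convex_weight "f k" "v k" "\<kappa> k" "s k" by (rule weight)
  have int: "integrable (brw_noise b (Suc n)) (\<lambda>\<zeta>. \<Prod>\<tau>\<in>{\<tau>}. h (brw_field \<zeta> \<tau>))"
  proof (rule Bochner_Integration.integrable_bound)
    show "integrable (brw_noise b (Suc n)) (\<lambda>\<zeta>. p + q * (brw_field \<zeta> \<tau> * brw_field \<zeta> \<tau>))"
      using Suc.prems(5) prob_space.finite_measure[OF prob_space_brw_noise]
      by (intro Bochner_Integration.integrable_add integrable_mult_right integrable_brw_field_product
          finite_measure.integrable_const)
    show "AE \<zeta> in brw_noise b (Suc n). norm (\<Prod>\<tau>\<in>{\<tau>}. h (brw_field \<zeta> \<tau>))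
       \<le> norm (p + q * (brw_field \<zeta> \<tau> * brw_field \<zeta> \<tau>))"
      using Suc.prems(2-4) by (auto simp: power2_eq_square intro: order_trans[OF _ abs_ge_self])
  qed (use Suc.prems in \<open>simp add: measurable_brw_field_comp exp_bounded_measurable\<close>)
  have bd: "\<bar>mean h x\<bar> \<le> (p + q) + (q * \<rho>\<^sup>2) * x\<^sup>2" for x
  proof -
    have eb: "exp_bounded (\<lambda>y. p + q * y\<^sup>2)" by (intro exp_bounded_intros)
    have lower: "(-1) * (p + q * y\<^sup>2) \<le> h y" for y using Suc.prems(4)[of y] unfolding mult_minus1 by linarith
    have "mean h x \<le> mean (\<lambda>y. p + q * y\<^sup>2) x"
      using Suc.prems(4) by (intro mean_mono Suc.prems eb) (auto simp: abs_le_iff)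
    moreover have "mean (\<lambda>y. (-1) * (p + q * y\<^sup>2)) x \<le> mean h x"
      by (intro mean_mono Suc.prems exp_bounded_mult exp_bounded_const eb lower)
    moreover have "mean (\<lambda>y. p + q * y\<^sup>2) x \<le> (p + q) + (q * \<rho>\<^sup>2) * x\<^sup>2"
      using mult_left_mono[OF mean_square_le[of x] Suc.prems(3)]
      by (simp add: mean_add mean_const mean_cmult exp_bounded_intros algebra_simps)
    ultimately show ?thesis unfolding mean_cmult by linarith
  qed
  have "\<bar>\<integral>\<zeta>. (\<Prod>\<sigma>\<in>words b (Suc n). f k (brw_field \<zeta> \<sigma>)) * h (brw_field \<zeta> \<tau>) \<partial>brw_noise b (Suc n)\<bar> =
    \<bar>\<integral>\<zeta>. (\<Prod>\<sigma>\<in>words b n. f (Suc k) (brw_field \<zeta> \<sigma>)) * mean h (brw_field \<zeta> (butlast \<tau>)) \<partial>brw_noise b n\<bar>"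
    using brw_integrate_marked_leaves[OF _ Suc.prems(1) int] Suc.prems(5) by (simp add: f_Suc)
  also have "\<dots> \<le> f (n + Suc k) 0 * ((p + q) + (q * \<rho>\<^sup>2) * (2 + real (k0 - Suc k)))"
  proof (rule Suc.IH)
    show "exp_bounded (mean h)"
      by (rule exp_bounded_mean[OF Suc.prems(1) _ bd]) (intro exp_bounded_intros)
    show "butlast \<tau> \<in> words b n" using Suc.prems(5) by (rule butlast_in_words)
  qed (use Suc.prems bd in auto)
  also have "\<dots> \<le> f (Suc n + k) 0 * (p + q * (2 + real (k0 - k)))"
  proof -
    \<comment> \<open>Before level \<open>k0\<close> the added \<open>1\<close> is paid for by the
      decrease of \<open>k0 - k\<close>. Afterwards this truncated difference is \<open>0\<close>,
      and \<open>1 + (4 / 9) * 2 \<le> 2\<close>.\<close>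
    have "1 + \<rho>\<^sup>2 * (2 + real (k0 - Suc k)) \<le> 2 + real (k0 - k)"
    proof (cases "k \<ge> k0")
      case True
      then have "\<rho>\<^sup>2 \<le> (2 / 3)\<^sup>2"
        using contracting[OF True] rho_pos by (intro power_mono) auto
      with True show ?thesis by (simp add: power2_eq_square)
    next
      case False
      have "\<rho>\<^sup>2 \<le> 1" using rho_pos rho_le_1 by (intro power_le_one) auto
      then have "\<rho>\<^sup>2 * (2 + real (k0 - Suc k)) \<le> 2 + real (k0 - Suc k)"
        by (intro mult_left_le_one_le) auto
      with False show ?thesis by (simp add: of_nat_diff)
    qed
    from mult_left_mono[OF this Suc.prems(3)]
    have "(p + q) + (q * \<rho>\<^sup>2) * (2 + real (k0 - Suc k)) \<le> p + q * (2 + real (k0 - k))"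
      by (simp add: algebra_simps)
    then show ?thesis
      using convex_weight.f_pos[OF weight, of "Suc n + k" 0] by (simp add: mult_left_mono)
  qed
  finally show ?case .
qed

text \<open>As long as the two leaves are distinct, their conditional means factorise and the common
  odd observable contracts at every level past \<open>k0\<close>. When the leaves merge, the second
  moment of the contracted observable is bounded by \<open>one_point_bound\<close>. The truncated
  exponent counts the contracting levels, and the square appears because both leaves
  contribute.\<close>

lemma two_point_bound:
  assumes "exp_bounded h" "L \<ge> 0" "\<And>x. h (- x) = - h x" "\<And>x y. \<bar>h x - h y\<bar> \<le> L * \<bar>x - y\<bar>"
    and "\<tau>\<^sub>1 \<in> words b n" "\<tau>\<^sub>2 \<in> words b n"
  shows "\<bar>\<integral>\<zeta>. (\<Prod>\<sigma>\<in>words b n. f k (brw_field \<zeta> \<sigma>)) * (h (brw_field \<zeta> \<tau>\<^sub>1) * h (brw_field \<zeta> \<tau>\<^sub>2)) \<partial>brw_noise b n\<bar>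
    \<le> f (n + k) 0 * ((L * (2 / 3) ^ (tree_dist n \<tau>\<^sub>1 \<tau>\<^sub>2 - (k0 - k)))\<^sup>2 * (2 + real k0))"
  using assms
proof (induction n arbitrary: k h L \<tau>\<^sub>1 \<tau>\<^sub>2)
  case (0 k h L)
  from 0(3)[of 0] have "h 0 = 0" by simp
  with 0 convex_weight.f_pos[OF weight, of k 0] show ?case by simp
next
  case (Suc n)
  interpret convex_weight "f k" "v k" "\<kappa> k" "s k" by (rule weight)
  have h0: "h 0 = 0" using Suc.prems(3)[of 0] by simp
  have h_le: "\<bar>h x\<bar> \<le> L * \<bar>x\<bar>" for x using Suc.prems(4)[of x 0] h0 by simp
  show ?case
  proof (cases "\<tau>\<^sub>1 = \<tau>\<^sub>2")
    case True
    \<comment> \<open>Equal leaves have distance \<open>0\<close>, so the exponent vanishes. Since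
      \<open>h 0 = 0\<close>, the square of \<open>h\<close> satisfies the quadratic growth bound
      with \<open>p = 0\<close> and \<open>q = L\<^sup>2\<close>.\<close>
    have "\<bar>\<integral>\<zeta>. (\<Prod>\<sigma>\<in>words b (Suc n). f k (brw_field \<zeta> \<sigma>)) * (h (brw_field \<zeta> \<tau>\<^sub>1))\<^sup>2 \<partial>brw_noise b (Suc n)\<bar>
      \<le> f (Suc n + k) 0 * (0 + L\<^sup>2 * (2 + real (k0 - k)))"
    proof (rule one_point_bound[where h = "\<lambda>x. (h x)\<^sup>2"])
      show "\<bar>(h x)\<^sup>2\<bar> \<le> 0 + L\<^sup>2 * x\<^sup>2" for x
        using power_mono[OF h_le[of x], of 2] by (simp add: power_mult_distrib)
    qed (use Suc.prems in \<open>auto intro: exp_bounded_intros\<close>)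
    also have "\<dots> \<le> f (Suc n + k) 0 * (L\<^sup>2 * (2 + real k0))"
      using convex_weight.f_pos[OF weight, of "Suc n + k" 0]
      by (intro mult_left_mono) (auto intro!: mult_left_mono)
    finally show ?thesis using True Suc.prems by (simp add: power2_eq_square)
  next
    case False
    let ?d = "tree_dist n (butlast \<tau>\<^sub>1) (butlast \<tau>\<^sub>2)"
    have int: "integrable (brw_noise b (Suc n)) (\<lambda>\<zeta>. \<Prod>\<tau>\<in>{\<tau>\<^sub>1, \<tau>\<^sub>2}. h (brw_field \<zeta> \<tau>))"
    proof (rule Bochner_Integration.integrable_bound)
      show "integrable (brw_noise b (Suc n)) (\<lambda>\<zeta>. L\<^sup>2 * (brw_field \<zeta> \<tau>\<^sub>1 * brw_field \<zeta> \<tau>\<^sub>2))"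
        using Suc.prems by (intro integrable_mult_right integrable_brw_field_product)
      have "\<bar>h x\<bar> * \<bar>h y\<bar> \<le> L\<^sup>2 * (\<bar>x\<bar> * \<bar>y\<bar>)" for x y
        using mult_mono[OF h_le[of x] h_le[of y]] Suc.prems(2) by (simp add: power2_eq_square mult_ac)
      then show "AE \<zeta> in brw_noise b (Suc n). norm (\<Prod>\<tau>\<in>{\<tau>\<^sub>1, \<tau>\<^sub>2}. h (brw_field \<zeta> \<tau>))
         \<le> norm (L\<^sup>2 * (brw_field \<zeta> \<tau>\<^sub>1 * brw_field \<zeta> \<tau>\<^sub>2))"
        using False by (simp add: abs_mult)
    qed (use Suc.prems in \<open>auto intro!: borel_measurable_prod measurable_brw_field_comp exp_bounded_measurable\<close>)
    have lip: "\<bar>mean h x - mean h y\<bar> \<le> L * \<rho> * \<bar>x - y\<bar>" for x y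
      by (rule mean_lipschitz) (use Suc.prems in auto)
    have odd: "mean h (- x) = - mean h x" for x
      by (rule mean_odd) (rule Suc.prems)
    have bd: "\<bar>mean h x\<bar> \<le> L * \<rho> * \<bar>x\<bar>" for x
      using lip[of x 0] odd[of 0] by simp
    have "\<bar>\<integral>\<zeta>. (\<Prod>\<sigma>\<in>words b (Suc n). f k (brw_field \<zeta> \<sigma>)) * (h (brw_field \<zeta> \<tau>\<^sub>1) * h (brw_field \<zeta> \<tau>\<^sub>2)) \<partial>brw_noise b (Suc n)\<bar> =
      \<bar>\<integral>\<zeta>. (\<Prod>\<sigma>\<in>words b n. f (Suc k) (brw_field \<zeta> \<sigma>)) * (mean h (brw_field \<zeta> (butlast \<tau>\<^sub>1)) * mean h (brw_field \<zeta> (butlast \<tau>\<^sub>2))) \<partial>brw_noise b n\<bar>"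
      using brw_integrate_marked_leaves[OF _ Suc.prems(1) int] Suc.prems(5,6) False by (simp add: f_Suc)
    also have "\<dots> \<le> f (n + Suc k) 0 * ((L * \<rho> * (2 / 3) ^ (?d - (k0 - Suc k)))\<^sup>2 * (2 + real k0))"
    proof (rule Suc.IH)
      show "exp_bounded (mean h)"
        by (rule exp_bounded_mean[OF Suc.prems(1) _ bd]) (intro exp_bounded_intros)
    qed (use Suc.prems rho_pos lip odd butlast_in_words in auto)
    also have "\<dots> \<le> f (n + Suc k) 0 * ((L * (2 / 3) ^ (Suc ?d - (k0 - k)))\<^sup>2 * (2 + real k0))"
    proof -
      \<comment> \<open>Climbing one level either produces a factor \<open>2 / 3\<close>, when
        \<open>k \<ge> k0\<close>, or uses up one of the \<open>k0 - k\<close> free levels, where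
        \<open>\<rho> \<le> 1\<close> suffices and the exponent is unchanged.\<close>
      have "\<rho> * (2 / 3) ^ (?d - (k0 - Suc k)) \<le> (2 / 3) ^ (Suc ?d - (k0 - k))"
      proof (cases "k \<ge> k0")
        case True
        with mult_right_mono[OF contracting[OF True], of "(2 / 3) ^ ?d"] show ?thesis by simp
      next
        case False
        then have "Suc ?d - (k0 - k) = ?d - (k0 - Suc k)" by simp
        with rho_pos rho_le_1 show ?thesis by (simp add: mult_left_le_one_le)
      qed
      then have "L * \<rho> * (2 / 3) ^ (?d - (k0 - Suc k)) \<le> L * (2 / 3) ^ (Suc ?d - (k0 - k))"
        using Suc.prems(2) by (simp add: mult.assoc mult_left_mono)
      then have "(L * \<rho> * (2 / 3) ^ (?d - (k0 - Suc k)))\<^sup>2 \<le> (L * (2 / 3) ^ (Suc ?d - (k0 - k)))\<^sup>2"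
        using Suc.prems(2) rho_pos by (intro power_mono) auto
      then show ?thesis
        using convex_weight.f_pos[OF weight, of "n + Suc k" 0] by (intro mult_left_mono mult_right_mono) auto
    qed
    finally show ?thesis using tree_dist_Suc[OF Suc.prems(5,6) False] by simp
  qed
qed

end

section \<open>Power potentials\<close>

definition power_weight :: "real \<Rightarrow> real \<Rightarrow> real \<Rightarrow> real" where
  "power_weight lam \<alpha> x = exp (- (lam * \<bar>x\<bar> powr \<alpha>))"

definition signed_power :: "real \<Rightarrow> real \<Rightarrow> real" where
  "signed_power a x = sgn x * \<bar>x\<bar> powr a"

lemma has_derivative_abs_powr:
  assumes "\<alpha> > 1"
  shows "((\<lambda>x. \<bar>x\<bar> powr \<alpha>) has_real_derivative \<alpha> * signed_power (\<alpha> - 1) x) (at x)"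
proof -
  consider "x > 0" | "x < 0" | "x = 0" by linarith
  then show ?thesis
  proof cases
    case 1
    have "((\<lambda>x. x powr \<alpha>) has_real_derivative \<alpha> * signed_power (\<alpha> - 1) x) (at x)"
      using 1 by (auto intro!: derivative_eq_intros simp: signed_power_def powr_diff)
    then show ?thesis
      by (rule has_field_derivative_transform_within_open[where S = "{0<..}"]) (use 1 in auto)
  next
    case 2
    have "((\<lambda>x. (- x) powr \<alpha>) has_real_derivative \<alpha> * signed_power (\<alpha> - 1) x) (at x)"
      using 2 by (auto intro!: derivative_eq_intros simp: signed_power_def powr_diff)
    then show ?thesis
      by (rule has_field_derivative_transform_within_open[where S = "{..<0}"]) (use 2 in auto)
  next
    case 3
    \<comment> \<open>At the origin the difference quotient is bounded in absolute value by
      \<open>\<bar>h\<bar> powr (\<alpha> - 1)\<close>, which tends to \<open>0\<close> because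
      \<open>\<alpha> > 1\<close>.\<close>
    have "((\<lambda>h::real. \<bar>h\<bar> powr (\<alpha> - 1)) \<longlongrightarrow> 0 powr (\<alpha> - 1)) (at 0)"
      using assms by (intro tendsto_powr2 tendsto_rabs_zero tendsto_ident_at tendsto_const) auto
    then have lim: "((\<lambda>h::real. \<bar>h\<bar> powr (\<alpha> - 1)) \<longlongrightarrow> 0) (at 0)" by simp
    have "((\<lambda>h::real. (\<bar>0 + h\<bar> powr \<alpha> - \<bar>0\<bar> powr \<alpha>) / h) \<longlongrightarrow> 0) (at 0)"
    proof (rule Lim_null_comparison[OF _ lim])
      show "eventually (\<lambda>h::real. norm ((\<bar>0 + h\<bar> powr \<alpha> - \<bar>0\<bar> powr \<alpha>) / h) \<le> \<bar>h\<bar> powr (\<alpha> - 1)) (at 0)"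
        using eventually_neq_at_within[of 0] by eventually_elim (simp add: powr_diff)
    qed
    then show ?thesis
      using 3 by (simp add: DERIV_def signed_power_def)
  qed
qed

lemma continuous_on_signed_power:
  assumes "a > 0"
  shows "continuous_on UNIV (signed_power a)"
proof -
  have "signed_power a = (\<lambda>x. max 0 x powr a - max 0 (- x) powr a)"
    using assms by (auto simp: fun_eq_iff signed_power_def sgn_if max_def)
  moreover have "continuous_on UNIV (\<lambda>x. max 0 x powr a - max 0 (- x) powr a)"
    using assms by (intro continuous_on_diff continuous_on_powr' continuous_intros) auto
  ultimately show ?thesis by simp
qed

lemma exp_bounded_signed_power:
  assumes "a > 0"
  shows "exp_bounded (signed_power a)"
proof (rule exp_boundedI[of _ 1 a])
  show "signed_power a \<in> borel_measurable borel"
    by (rule borel_measurable_continuous_onI[OF continuous_on_signed_power[OF assms]])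
  show "\<bar>signed_power a x\<bar> \<le> 1 * exp (a * \<bar>x\<bar>)" for x
  proof (cases "x = 0")
    case False
    then have "ln \<bar>x\<bar> \<le> \<bar>x\<bar>" using ln_le_minus_one[of "\<bar>x\<bar>"] by linarith
    then have "a * ln \<bar>x\<bar> \<le> a * \<bar>x\<bar>" using assms by simp
    with False show ?thesis by (simp add: signed_power_def abs_mult powr_def)
  qed (simp add: signed_power_def)
qed

text \<open>Reflecting the pair if necessary, one may assume \<open>\<bar>y\<bar> \<le> x\<close>.
  Then \<open>(x - y) / 2 \<le> x\<close>, and the larger endpoint alone provides the
  increment.\<close>

lemma signed_power_increment:
  assumes "\<alpha> \<ge> 2" "y \<le> x"
  shows "(x - y) / 2 * ((x - y) / 2) powr (\<alpha> - 2) \<le> signed_power (\<alpha> - 1) x - signed_power (\<alpha> - 1) y"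
proof -
  have sp: "signed_power (\<alpha> - 1) z = z * \<bar>z\<bar> powr (\<alpha> - 2)" for z
  proof (cases "z = 0")
    case False
    then have "\<bar>z\<bar> powr (\<alpha> - 1) = \<bar>z\<bar> * \<bar>z\<bar> powr (\<alpha> - 2)"
      using powr_add[of "\<bar>z\<bar>" 1 "\<alpha> - 2"] by simp
    then show ?thesis using False by (simp add: signed_power_def sgn_mult_abs flip: mult.assoc)
  qed (simp add: signed_power_def)
  have key: "(x - y) / 2 * ((x - y) / 2) powr (\<alpha> - 2) \<le> x * x powr (\<alpha> - 2) - y * \<bar>y\<bar> powr (\<alpha> - 2)"
    if "y \<le> x" "\<bar>y\<bar> \<le> x" for x y :: real
  proof -
    have "(x - y) / 2 * ((x - y) / 2) powr (\<alpha> - 2) \<le> (x - y) / 2 * x powr (\<alpha> - 2)"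
      using that assms(1) by (intro mult_left_mono powr_mono2) auto
    also have "\<dots> \<le> x * x powr (\<alpha> - 2) - y * \<bar>y\<bar> powr (\<alpha> - 2)"
    proof (cases "y \<ge> 0")
      case True
      have "y * \<bar>y\<bar> powr (\<alpha> - 2) \<le> y * x powr (\<alpha> - 2)"
        using that assms(1) True by (intro mult_left_mono powr_mono2) auto
      moreover have "(x - y) / 2 * x powr (\<alpha> - 2) \<le> (x - y) * x powr (\<alpha> - 2)"
        using that by (intro mult_right_mono) auto
      ultimately show ?thesis unfolding left_diff_distrib[of x y] by linarith
    next
      case False
      have "(x - y) / 2 * x powr (\<alpha> - 2) \<le> x * x powr (\<alpha> - 2)"
        using that by (intro mult_right_mono) auto
      moreover have "y * \<bar>y\<bar> powr (\<alpha> - 2) \<le> 0"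
        using False by (simp add: mult_nonpos_nonneg)
      ultimately show ?thesis by linarith
    qed
    finally show ?thesis .
  qed
  show ?thesis
  proof (cases "\<bar>y\<bar> \<le> x")
    case True
    with key[OF assms(2) True] show ?thesis by (simp add: sp)
  next
    case False
    then have "\<bar>- x\<bar> \<le> - y" using assms(2) by auto
    with key[of "- x" "- y"] assms(2) show ?thesis by (simp add: sp)
  qed
qed

text \<open>Where the squared distance \<open>t\<^sup>2\<close> is at most \<open>1 / 2\<close>, the
  slack makes the lower bound nonpositive. Otherwise \<open>t \<ge> 1 / 2\<close>, and
  \<open>(t / 2) powr (\<alpha> - 2)\<close> is at least \<open>(1 / 4) powr (\<alpha> - 2)\<close>;
  this is the origin of the constant \<open>4 powr (- \<alpha>)\<close>. The slack stays below
  \<open>1\<close> so that the next weight has positive curvature.\<close>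

lemma convex_weight_power:
  assumes "lam > 0" "\<alpha> \<ge> 2"
  shows "convex_weight (power_weight lam \<alpha>) (\<lambda>x. lam * \<alpha> * signed_power (\<alpha> - 1) x)
    (lam * 4 powr (- \<alpha>)) (1 / 2)"
proof
  let ?v = "\<lambda>x. lam * \<alpha> * signed_power (\<alpha> - 1) x"
  show "power_weight lam \<alpha> x > 0" "power_weight lam \<alpha> x \<le> 1"
    "power_weight lam \<alpha> (- x) = power_weight lam \<alpha> x" for x
    using assms by (auto simp: power_weight_def)
  show "(power_weight lam \<alpha> has_real_derivative - ?v x * power_weight lam \<alpha> x) (at x)" for x
    unfolding power_weight_def[abs_def]
    using DERIV_fun_exp[OF DERIV_minus[OF DERIV_cmult[OF has_derivative_abs_powr[of \<alpha> x]]], of lam] assms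
    by (simp add: mult_ac)
  show "continuous_on UNIV ?v"
    using assms by (intro continuous_intros continuous_on_signed_power) auto
  show "exp_bounded ?v"
    using assms by (intro exp_bounded_intros exp_bounded_signed_power) auto
  have mono: "lam * 4 powr (- \<alpha>) * ((x - y)\<^sup>2 - 1 / 2) \<le> (x - y) * (?v x - ?v y)" if "y \<le> x" for x y
  proof -
    define t where "t = x - y"
    have "t \<ge> 0" using that by (simp add: t_def)
    have inc: "t / 2 * (t / 2) powr (\<alpha> - 2) \<le> signed_power (\<alpha> - 1) x - signed_power (\<alpha> - 1) y"
      unfolding t_def by (rule signed_power_increment) (use assms that in auto)
    have "4 powr (- \<alpha>) * (t\<^sup>2 - 1 / 2) \<le> t * (t / 2 * (t / 2) powr (\<alpha> - 2))"
    proof (cases "t\<^sup>2 \<le> 1 / 2")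
      case True
      then have "4 powr (- \<alpha>) * (t\<^sup>2 - 1 / 2) \<le> 0" by (simp add: mult_nonneg_nonpos)
      also have "0 \<le> t * (t / 2 * (t / 2) powr (\<alpha> - 2))" using \<open>t \<ge> 0\<close> by simp
      finally show ?thesis .
    next
      case False
      have "(1 / 2)\<^sup>2 \<le> t\<^sup>2" using False by (simp add: power2_eq_square)
      then have "1 / 2 \<le> t" using \<open>t \<ge> 0\<close> by (rule power2_le_imp_le)
      then have "(1 / 4) powr (\<alpha> - 2) \<le> (t / 2) powr (\<alpha> - 2)"
        using assms by (intro powr_mono2) auto
      moreover have "4 powr (- \<alpha>) * 2 \<le> (1 / 4 :: real) powr (\<alpha> - 2)"
        by (simp add: powr_diff powr_divide powr_minus_divide divide_right_mono)
      ultimately have "4 powr (- \<alpha>) * 2 \<le> (t / 2) powr (\<alpha> - 2)" by linarith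
      then have "t\<^sup>2 / 2 * (4 powr (- \<alpha>) * 2) \<le> t\<^sup>2 / 2 * (t / 2) powr (\<alpha> - 2)"
        by (intro mult_left_mono) auto
      moreover have "4 powr (- \<alpha>) * (t\<^sup>2 - 1 / 2) \<le> 4 powr (- \<alpha>) * t\<^sup>2"
        by (intro mult_left_mono) auto
      moreover have "4 powr (- \<alpha>) * t\<^sup>2 = t\<^sup>2 / 2 * (4 powr (- \<alpha>) * 2)" by simp
      moreover have "t\<^sup>2 / 2 * (t / 2) powr (\<alpha> - 2) = t * (t / 2 * (t / 2) powr (\<alpha> - 2))"
        by (simp add: power2_eq_square)
      ultimately show ?thesis by linarith
    qed
    also have "\<dots> \<le> t * (signed_power (\<alpha> - 1) x - signed_power (\<alpha> - 1) y)"
      using inc \<open>t \<ge> 0\<close> by (rule mult_left_mono)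
    also have "\<dots> \<le> \<alpha> * (t * (signed_power (\<alpha> - 1) x - signed_power (\<alpha> - 1) y))"
    proof -
      have "0 \<le> t / 2 * (t / 2) powr (\<alpha> - 2)" using \<open>t \<ge> 0\<close> by simp
      then have "0 \<le> t * (signed_power (\<alpha> - 1) x - signed_power (\<alpha> - 1) y)"
        using inc \<open>t \<ge> 0\<close> by (intro mult_nonneg_nonneg) linarith+
      from mult_right_mono[OF _ this, of 1 \<alpha>] assms show ?thesis by simp
    qed
    finally have "4 powr (- \<alpha>) * (t\<^sup>2 - 1 / 2) \<le> \<alpha> * (t * (signed_power (\<alpha> - 1) x - signed_power (\<alpha> - 1) y))" .
    from mult_left_mono[OF this, of lam] assms show ?thesis
      by (simp add: t_def algebra_simps)
  qed
  show "lam * 4 powr (- \<alpha>) * ((x - y)\<^sup>2 - 1 / 2) \<le> (x - y) * (?v x - ?v y)" for x y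
  proof (cases "y \<le> x")
    case False
    with mono[of x y] show ?thesis by (simp add: power2_commute algebra_simps)
  qed (rule mono)
qed (use assms in auto)

section \<open>Growth of the convexity constant along the levels\<close>

primrec heat_flow :: "nat \<Rightarrow> (real \<Rightarrow> real) \<Rightarrow> nat \<Rightarrow> real \<Rightarrow> real" where
  "heat_flow b f 0 = f"
| "heat_flow b f (Suc k) = (\<lambda>x. heat (heat_flow b f k) x ^ b)"

text \<open>The negative logarithmic derivatives of the weights in \<open>heat_flow\<close>, when
  \<open>v\<close> is that of \<open>f\<close>.\<close>

primrec drift_flow :: "nat \<Rightarrow> (real \<Rightarrow> real) \<Rightarrow> (real \<Rightarrow> real) \<Rightarrow> nat \<Rightarrow> real \<Rightarrow> real" where
  "drift_flow b f v 0 = v"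
| "drift_flow b f v (Suc k) = (\<lambda>x. b * (x - tilted_mean (heat_flow b f k) (\<lambda>y. y) x))"

primrec curvature_flow :: "nat \<Rightarrow> real \<Rightarrow> nat \<Rightarrow> real" where
  "curvature_flow b \<kappa> 0 = \<kappa>"
| "curvature_flow b \<kappa> (Suc k) =
    b * (curvature_flow b \<kappa> k * (1 - (if k = 0 then 1 / 2 else 0)) / (1 + curvature_flow b \<kappa> k))"

lemma convex_weight_flow:
  assumes "convex_weight f v \<kappa> (1 / 2)" "b \<ge> 1"
  shows "convex_weight (heat_flow b f k) (drift_flow b f v k) (curvature_flow b \<kappa> k)
    (if k = 0 then 1 / 2 else 0)"
proof (induction k)
  case (Suc k)
  from convex_weight.convex_weight_heat_power[OF Suc assms(2)] show ?case by simp
qed (use assms in simp)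

text \<open>With \<open>b \<ge> 2\<close>, the map \<open>x \<mapsto> b * x / (1 + x)\<close>
  multiplies by at least \<open>4 / 3\<close> while \<open>x \<le> 1 / 2\<close>, and it keeps
  \<open>x \<ge> 1 / 2\<close> above \<open>1 / 2\<close>. The bound starts at index
  \<open>1\<close>, after the step in which the slack costs a factor \<open>1 / 2\<close>; there
  \<open>b / 2 \<ge> 1\<close> compensates.\<close>

lemma curvature_flow_lower_bound:
  assumes "b \<ge> 2" "\<kappa> > 0"
  shows "min (1 / 2) ((4 / 3) ^ k * (min 1 \<kappa> / 2)) \<le> curvature_flow b \<kappa> (Suc k)"
proof (induction k)
  case 0
  have "min 1 \<kappa> / 2 \<le> \<kappa> / (1 + \<kappa>)"
    using assms(2) by (auto simp: min_def field_simps)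
  also have "\<dots> \<le> (b / 2) * (\<kappa> / (1 + \<kappa>))"
    using assms mult_right_mono[of 1 "b / 2" "\<kappa> / (1 + \<kappa>)"] by simp
  finally show ?case by (simp add: field_simps)
next
  case (Suc k)
  define x where "x = curvature_flow b \<kappa> (Suc k)"
  have "0 < min (1 / 2) ((4 / 3) ^ k * (min 1 \<kappa> / 2))" using assms(2) by simp
  with Suc have x: "x > 0" unfolding x_def by linarith
  have eq: "curvature_flow b \<kappa> (Suc (Suc k)) = b * (x / (1 + x))" by (simp add: x_def)
  have le: "2 * (x / (1 + x)) \<le> b * (x / (1 + x))"
    using assms(1) x by (intro mult_right_mono) auto
  show ?case
  proof (cases "x \<ge> 1 / 2")
    case True
    then have "1 / 2 \<le> 2 * (x / (1 + x))" by (simp add: field_simps)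
    with le show ?thesis unfolding eq by linarith
  next
    case False
    then have "(4 / 3) * x \<le> 2 * (x / (1 + x))" using x by (simp add: field_simps)
    moreover have "(4 / 3) ^ k * (min 1 \<kappa> / 2) \<le> x"
      using Suc False unfolding x_def[symmetric] by linarith
    ultimately have "(4 / 3) ^ Suc k * (min 1 \<kappa> / 2) \<le> b * (x / (1 + x))"
      using le unfolding power_Suc mult.assoc by linarith
    then show ?thesis unfolding eq by (rule min.coboundedI2)
  qed
qed

lemma ex_power_ge:
  assumes "0 < m" "m \<le> (1 :: real)"
  shows "\<exists>j. 1 \<le> (4 / 3) ^ j * m \<and> real j \<le> 1 + 4 * ln (1 / m)"
proof (intro exI conjI)
  \<comment> \<open>The factor \<open>4\<close> comes from \<open>ln (4 / 3) \<ge> 1 / 4\<close>, a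
    consequence of \<open>ln (3 / 4) \<le> - 1 / 4\<close>.\<close>
  let ?j = "nat \<lceil>4 * ln (1 / m)\<rceil>"
  have nn: "ln (1 / m) \<ge> 0" using assms by simp
  then show "real ?j \<le> 1 + 4 * ln (1 / m)" by linarith
  have ge: "4 * ln (1 / m) \<le> real ?j" by linarith
  have "1 / 4 \<le> ln (4 / 3 :: real)"
    using ln_le_minus_one[of "3 / 4 :: real"] ln_div[of 3 "4 :: real"] ln_div[of 4 "3 :: real"] by simp
  then have "real ?j * (1 / 4) \<le> real ?j * ln (4 / 3)" by (intro mult_left_mono) auto
  with ge have "ln (1 / m) \<le> real ?j * ln (4 / 3)" by linarith
  also have "\<dots> = ln ((4 / 3) ^ ?j)" by (simp add: ln_realpow)
  finally have "1 / m \<le> (4 / 3) ^ ?j" using assms by (subst (asm) ln_le_cancel_iff) auto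
  then show "1 \<le> (4 / 3) ^ ?j * m" using assms by (simp add: field_simps)
qed

text \<open>After about \<open>4 * ln (1 / \<kappa>)\<close> levels the curvature exceeds
  \<open>1 / 2\<close>, which is exactly \<open>1 / (1 + \<kappa>) \<le> 2 / 3\<close>. The initial
  constant \<open>lam * 4 powr (- \<alpha>)\<close> makes this number logarithmic in
  \<open>1 / lam\<close> and linear in \<alpha>.\<close>

lemma power_weight_flow:
  assumes "b \<ge> 2" "lam > 0" "\<alpha> \<ge> 2"
  obtains v \<kappa> s k0 where "weight_flow b (heat_flow b (power_weight lam \<alpha>)) v \<kappa> s k0"
    "real k0 \<le> 2 + 4 * log_plus (1 / lam) + 8 * \<alpha>"
proof -
  define \<kappa> where "\<kappa> = lam * 4 powr (- \<alpha>)"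
  define m where "m = min 1 \<kappa>"
  have "\<kappa> > 0" using assms by (simp add: \<kappa>_def)
  then have m: "0 < m" "m \<le> 1" by (auto simp: m_def)
  obtain j where j: "1 \<le> (4 / 3) ^ j * m" "real j \<le> 1 + 4 * ln (1 / m)"
    using ex_power_ge[OF m] by blast
  have "weight_flow b (heat_flow b (power_weight lam \<alpha>))
     (drift_flow b (power_weight lam \<alpha>) (\<lambda>x. lam * \<alpha> * signed_power (\<alpha> - 1) x))
     (curvature_flow b \<kappa>) (\<lambda>k. if k = 0 then 1 / 2 else 0) (Suc j)"
  proof (rule weight_flow.intro)
    show weight: "convex_weight (heat_flow b (power_weight lam \<alpha>) k)
        (drift_flow b (power_weight lam \<alpha>) (\<lambda>x. lam * \<alpha> * signed_power (\<alpha> - 1) x) k)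
        (curvature_flow b \<kappa> k) (if k = 0 then 1 / 2 else 0)" for k
      unfolding \<kappa>_def using assms by (intro convex_weight_flow convex_weight_power) auto
    fix k assume k: "Suc j \<le> k"
    then obtain i where i: "k = Suc i" "j \<le> i" by (cases k) auto
    have "1 / 2 \<le> (4 / 3) ^ j * (m / 2)" using j by simp
    also have "\<dots> \<le> (4 / 3) ^ i * (m / 2)" using i m by (intro mult_right_mono power_increasing) auto
    finally have *: "1 / 2 \<le> curvature_flow b \<kappa> k"
      using curvature_flow_lower_bound[OF assms(1) \<open>\<kappa> > 0\<close>, of i] unfolding i m_def by linarith
    have "1 / (1 + x) \<le> 2 / 3" if "1 / 2 \<le> x" for x :: real
      using that by (simp add: field_simps)
    from this[OF *] i show "convex_weight.\<rho> (curvature_flow b \<kappa> k) (if k = 0 then 1 / 2 else 0) \<le> 2 / 3"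
      unfolding convex_weight.\<rho>_def[OF weight] by simp
  qed simp
  moreover have "real (Suc j) \<le> 2 + 4 * log_plus (1 / lam) + 8 * \<alpha>"
  proof -
    have ln4: "ln (4 :: real) \<le> 2"
      using ln_realpow[of "2 :: real" 2] ln_le_minus_one[of "2 :: real"] by simp
    have "ln (1 / \<kappa>) = ln (1 / lam) + \<alpha> * ln 4"
      using assms by (simp add: \<kappa>_def ln_div ln_mult ln_powr)
    also have "\<dots> \<le> log_plus (1 / lam) + \<alpha> * 2"
      using assms ln4 by (intro add_mono mult_left_mono) (auto simp: log_plus_def)
    finally have 1: "ln (1 / \<kappa>) \<le> log_plus (1 / lam) + \<alpha> * 2" .
    have "log_plus (1 / lam) \<ge> 0" by (simp add: log_plus_def)
    with 1 assms have "ln (1 / m) \<le> log_plus (1 / lam) + \<alpha> * 2"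
      by (cases "\<kappa> \<le> 1") (auto simp: m_def)
    with j(2) show ?thesis by simp
  qed
  ultimately show thesis by (rule that)
qed

section \<open>The two-point function as a ratio of noise integrals, and final estimates\<close>

lemma tilted_law_two_point:
  assumes "lam > 0" "\<tau>\<^sub>1 \<in> words b n" "\<tau>\<^sub>2 \<in> words b n"
  shows "(\<integral>\<Phi>. \<Phi> \<tau>\<^sub>1 * \<Phi> \<tau>\<^sub>2 \<partial>tilted_law b n (power_potential lam \<alpha>)) =
    (\<integral>\<zeta>. (\<Prod>\<sigma>\<in>words b n. power_weight lam \<alpha> (brw_field \<zeta> \<sigma>)) * (brw_field \<zeta> \<tau>\<^sub>1 * brw_field \<zeta> \<tau>\<^sub>2) \<partial>brw_noise b n)
    / (\<integral>\<zeta>. (\<Prod>\<sigma>\<in>words b n. power_weight lam \<alpha> (brw_field \<zeta> \<sigma>)) \<partial>brw_noise b n)"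
proof -
  interpret prob_space "brw_law b n" by (rule prob_space_brw_law)
  define w where "w \<Phi> = (\<Prod>\<sigma>\<in>words b n. power_weight lam \<alpha> (\<Phi> \<sigma>))" for \<Phi>
  have gw: "gibbs_weight b n (power_potential lam \<alpha>) \<Phi> = ennreal (w \<Phi>)" for \<Phi>
    by (simp add: gibbs_weight_power_potential w_def power_weight_def exp_sum flip: sum_negf)
  have w: "0 < w \<Phi>" "w \<Phi> \<le> 1" for \<Phi>
    using assms(1) unfolding w_def power_weight_def by (auto intro!: prod_pos prod_le_1)
  have w_meas: "w \<in> borel_measurable (brw_law b n)"
    unfolding w_def[abs_def] power_weight_def by measurable
  have w_int: "integrable (brw_law b n) w"
    using w w_meas by (intro integrable_const_bound[of _ 1]) (auto simp: less_imp_le)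
  define Z where "Z = (\<integral>\<Phi>. w \<Phi> \<partial>brw_law b n)"
  have Z_eq: "(\<integral>\<^sup>+ \<Psi>. gibbs_weight b n (power_potential lam \<alpha>) \<Psi> \<partial>brw_law b n) = ennreal Z"
    unfolding gw Z_def using w w_int by (intro nn_integral_eq_integral) (auto simp: less_imp_le)
  have Z_pos: "Z > 0"
    using normaliser_power(1)[OF assms(1), of b n \<alpha>] unfolding Z_eq
    by (simp add: ennreal_eq_0_iff)
  have "tilted_law b n (power_potential lam \<alpha>) = density (brw_law b n) (\<lambda>\<Phi>. ennreal (w \<Phi> / Z))"
    unfolding tilted_law_def Z_eq gw using w Z_pos by (simp add: divide_ennreal less_imp_le)
  then have "(\<integral>\<Phi>. \<Phi> \<tau>\<^sub>1 * \<Phi> \<tau>\<^sub>2 \<partial>tilted_law b n (power_potential lam \<alpha>)) =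
      (\<integral>\<Phi>. (w \<Phi> / Z) *\<^sub>R (\<Phi> \<tau>\<^sub>1 * \<Phi> \<tau>\<^sub>2) \<partial>brw_law b n)"
    using w Z_pos w_meas borel_measurable_integrable[OF integrable_brw_law_product[OF assms(2,3)]]
    by (simp only:) (subst integral_density, auto simp: less_imp_le)
  also have "\<dots> = (\<integral>\<Phi>. w \<Phi> * (\<Phi> \<tau>\<^sub>1 * \<Phi> \<tau>\<^sub>2) \<partial>brw_law b n) / Z"
    by simp
  also have "(\<integral>\<Phi>. w \<Phi> * (\<Phi> \<tau>\<^sub>1 * \<Phi> \<tau>\<^sub>2) \<partial>brw_law b n) =
    (\<integral>\<zeta>. (\<Prod>\<sigma>\<in>words b n. power_weight lam \<alpha> (brw_field \<zeta> \<sigma>)) * (brw_field \<zeta> \<tau>\<^sub>1 * brw_field \<zeta> \<tau>\<^sub>2) \<partial>brw_noise b n)"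
    using borel_measurable_times[OF w_meas borel_measurable_integrable[OF integrable_brw_law_product[OF assms(2,3)]]]
      assms(2,3) unfolding brw_law_def
    by (subst integral_distr[OF measurable_brw_endpoints]) (simp_all add: w_def cong: prod.cong)
  also have "Z = (\<integral>\<zeta>. (\<Prod>\<sigma>\<in>words b n. power_weight lam \<alpha> (brw_field \<zeta> \<sigma>)) \<partial>brw_noise b n)"
    using w_meas unfolding Z_def brw_law_def
    by (subst integral_distr[OF measurable_brw_endpoints]) (simp_all add: w_def cong: prod.cong)
  finally show ?thesis .
qed

text \<open>Absorbs the logarithm into the exponent of the theorem. For
  \<open>\<alpha> \<le> 4\<close> the term with \<open>1 / \<alpha>\<close> suffices, since
  \<open>1 / \<alpha> \<ge> 1 / 4\<close>. For \<open>\<alpha> > 4\<close> and small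
  \<open>lam\<close>, the power of \<open>lam\<close> dominates the square of the logarithm divided
  by \<alpha>, up to a constant.\<close>

lemma log_plus_le:
  assumes "lam > 0" "2 \<le> \<alpha>" "\<alpha> \<le> \<alpha>s"
  shows "8 * log_plus (1 / lam) \<le>
    32 * (lam powr (- ((\<alpha> - 2) / \<alpha>\<^sup>2)) + 1 / \<alpha> * log_plus (1 / lam)) + 4 * \<alpha>s\<^sup>2"
proof -
  let ?L = "log_plus (1 / lam)"
  have L: "?L \<ge> 0" by (simp add: log_plus_def)
  show ?thesis
  proof (cases "\<alpha> \<le> 4")
    case True
    then have "8 * ?L \<le> 32 * (1 / \<alpha> * ?L)"
      using assms(2) L mult_right_mono[of "\<alpha>" 4 ?L] by (simp add: field_simps)
    moreover have "0 \<le> lam powr (- ((\<alpha> - 2) / \<alpha>\<^sup>2))" "0 \<le> \<alpha>s\<^sup>2" by auto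
    ultimately show ?thesis unfolding distrib_left by linarith
  next
    case False
    have "8 * ?L \<le> 32 * lam powr (- ((\<alpha> - 2) / \<alpha>\<^sup>2)) + 4 * \<alpha>\<^sup>2"
    proof (cases "lam < 1")
      case lam: True
      define u where "u = ?L / (2 * \<alpha>)"
      have u: "u \<ge> 0" using L assms(2) by (simp add: u_def)
      have Lu: "?L = 2 * \<alpha> * u" using assms(2) by (simp add: u_def)
      have lnlam: "ln lam = - ?L"
        using lam assms(1) by (simp add: log_plus_def ln_div)
      \<comment> \<open>Thus
        \<open>(\<alpha> - 2) / \<alpha>\<^sup>2 \<ge> 1 / (2 * \<alpha>)\<close>, so the power of
        \<open>lam\<close> is at least \<open>exp u\<close>; this dictates the normalisation of
        \<open>u\<close>.\<close>
      have "\<alpha> / 2 \<le> \<alpha> - 2" using False by simp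
      then have "(\<alpha> / 2) / \<alpha>\<^sup>2 * ?L \<le> (\<alpha> - 2) / \<alpha>\<^sup>2 * ?L"
        using L by (intro mult_right_mono divide_right_mono) auto
      moreover have "(\<alpha> / 2) / \<alpha>\<^sup>2 * ?L = u"
        using assms(2) by (simp add: u_def power2_eq_square field_simps)
      ultimately have "exp u \<le> lam powr (- ((\<alpha> - 2) / \<alpha>\<^sup>2))"
        using assms(1) by (simp add: powr_def lnlam)
      moreover have "u\<^sup>2 / 2 \<le> exp u"
        using exp_lower_Taylor_quadratic[OF u] u by linarith
      \<comment> \<open>The arithmetic-geometric inequality splits the product
        \<open>\<alpha> * u\<close>: the part \<open>16 * u\<^sup>2\<close> is at most
        \<open>32 * exp u\<close>, and \<open>4 * \<alpha>\<^sup>2\<close> goes into the constant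
        depending on the upper bound for \<alpha>.\<close>
      moreover have "8 * (2 * \<alpha> * u) \<le> 16 * u\<^sup>2 + 4 * \<alpha>\<^sup>2"
        using zero_le_power2[of "4 * u - 2 * \<alpha>"] by (simp add: power2_eq_square algebra_simps)
      ultimately show ?thesis unfolding Lu by linarith
    next
      case lam: False
      then have "?L = 0" using assms(1) by (simp add: log_plus_def ln_div)
      then show ?thesis by simp
    qed
    moreover have "\<alpha>\<^sup>2 \<le> \<alpha>s\<^sup>2" using assms by (intro power_mono) auto
    moreover have "0 \<le> 1 / \<alpha> * ?L" using L assms(2) by simp
    ultimately show ?thesis unfolding distrib_left by linarith
  qed
qed

text \<open>The truncated difference is at least \<open>real d - real k\<close>. Since
  \<open>2 * ln (3 / 2) \<le> 1\<close>, the lost levels cost at most \<open>exp (real k)\<close>,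
  and the linear prefactor costs at most \<open>2 * exp (real k)\<close>.\<close>

lemma two_thirds_power_le:
  "((2 / 3) ^ (d - k))\<^sup>2 * (2 + real k) \<le> 2 * exp (- (2 * ln (3 / 2)) * real d + 2 * real k)"
proof -
  let ?c = "ln (3 / 2 :: real)"
  have c: "0 \<le> ?c" "?c \<le> 1 / 2" using ln_le_minus_one[of "3 / 2 :: real"] by auto
  have "(2 / 3 :: real) = exp (- ?c)" by (simp add: exp_minus)
  then have "((2 / 3 :: real) ^ (d - k))\<^sup>2 = exp (- ?c) ^ ((d - k) * 2)"
    by (simp only: power_mult)
  also have "\<dots> = exp (- (2 * ?c * real (d - k)))"
    by (simp flip: exp_of_nat_mult add: mult_ac)
  also have "\<dots> \<le> exp (- (2 * ?c) * real d + real k)"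
  proof -
    have "2 * ?c * (real d - real k) \<le> 2 * ?c * real (d - k)" using c by (intro mult_left_mono) auto
    moreover have "2 * ?c * real k \<le> 1 * real k" using c by (intro mult_right_mono) auto
    ultimately show ?thesis by (simp add: algebra_simps)
  qed
  finally have "((2 / 3) ^ (d - k))\<^sup>2 \<le> exp (- (2 * ?c) * real d + real k)" .
  moreover have "2 + real k \<le> 2 * exp (real k)" using exp_ge_add_one_self[of "real k"] by linarith
  ultimately have "((2 / 3) ^ (d - k))\<^sup>2 * (2 + real k) \<le> exp (- (2 * ?c) * real d + real k) * (2 * exp (real k))"
    by (intro mult_mono) auto
  also have "\<dots> = 2 * exp (- (2 * ?c) * real d + 2 * real k)"
    by (simp flip: exp_add add: mult_ac)
  finally show ?thesis .
qed

theorem theorem1p7: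
  fixes b :: nat
  assumes "b \<ge> 2"
  shows "\<exists>C c :: real. C > 0 \<and> c > 0 \<and>
    (\<forall>\<alpha>s :: real. \<alpha>s \<ge> 2 \<longrightarrow>
      (\<exists>D :: real. D > 0 \<and>
        (\<forall>(\<alpha> :: real) (lam :: real) (n :: nat) \<tau>\<^sub>1 \<tau>\<^sub>2.
          \<alpha> \<in> {2..\<alpha>s} \<longrightarrow> lam > 0 \<longrightarrow> n \<ge> 1 \<longrightarrow>
          \<tau>\<^sub>1 \<in> words b n \<longrightarrow> \<tau>\<^sub>2 \<in> words b n \<longrightarrow>
          \<bar>\<integral>\<Phi>. \<Phi> \<tau>\<^sub>1 * \<Phi> \<tau>\<^sub>2 \<partial>tilted_law b n (power_potential lam \<alpha>)\<bar>
            \<le> C * exp (- c * real (tree_dist n \<tau>\<^sub>1 \<tau>\<^sub>2)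
                 + C * (lam powr (- ((\<alpha> - 2) / \<alpha>\<^sup>2)) + 1 / \<alpha> * log_plus (1 / lam) + D)))))"
proof (intro exI conjI allI impI)
  \<comment> \<open>The rate is \<open>2 * ln (3 / 2)\<close> because each of the two leaves
    contributes \<open>2 / 3\<close> per level. The constant \<open>32\<close> is the coefficient in
    \<open>log_plus_le\<close> and also exceeds the prefactor \<open>2\<close>.\<close>
  show "(32 :: real) > 0" "2 * ln (3 / 2 :: real) > 0" by auto
  fix \<alpha>s :: real assume \<alpha>s: "\<alpha>s \<ge> 2"
  \<comment> \<open>The square absorbs the constant of \<open>log_plus_le\<close>; the other two
    summands absorb the parts \<open>16 * \<alpha>\<close> and \<open>4\<close> of twice the bound
    on \<open>k0\<close>.\<close>
  show "\<alpha>s\<^sup>2 + \<alpha>s + 1 > 0" using \<alpha>s by (intro add_nonneg_pos add_nonneg_nonneg) auto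
  fix \<alpha> lam :: real and n :: nat and \<tau>\<^sub>1 \<tau>\<^sub>2
  assume \<alpha>: "\<alpha> \<in> {2..\<alpha>s}" and lam: "lam > 0" and \<tau>: "\<tau>\<^sub>1 \<in> words b n" "\<tau>\<^sub>2 \<in> words b n"
  let ?f = "heat_flow b (power_weight lam \<alpha>)" and ?d = "tree_dist n \<tau>\<^sub>1 \<tau>\<^sub>2"
  from \<alpha> have "2 \<le> \<alpha>" by simp
  obtain v \<kappa> s k0 where flow: "weight_flow b ?f v \<kappa> s k0"
    and k0: "real k0 \<le> 2 + 4 * log_plus (1 / lam) + 8 * \<alpha>"
    by (rule power_weight_flow[OF assms lam \<open>2 \<le> \<alpha>\<close>])
  interpret weight_flow b ?f v \<kappa> s k0 by (rule flow)
  let ?B = "\<integral>\<zeta>. (\<Prod>\<sigma>\<in>words b n. ?f 0 (brw_field \<zeta> \<sigma>)) * (brw_field \<zeta> \<tau>\<^sub>1 * brw_field \<zeta> \<tau>\<^sub>2) \<partial>brw_noise b n"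
  have Z: "(\<integral>\<zeta>. (\<Prod>\<sigma>\<in>words b n. ?f 0 (brw_field \<zeta> \<sigma>)) \<partial>brw_noise b n) = ?f n 0"
    using partition_function[of n 0] by simp
  have pos: "?f n 0 > 0" by (rule convex_weight.f_pos[OF weight])
  have "\<bar>\<integral>\<Phi>. \<Phi> \<tau>\<^sub>1 * \<Phi> \<tau>\<^sub>2 \<partial>tilted_law b n (power_potential lam \<alpha>)\<bar> = \<bar>?B\<bar> / ?f n 0"
    using tilted_law_two_point[OF lam \<tau>, of \<alpha>] Z pos by simp
  \<comment> \<open>The observable is the identity, which is odd with Lipschitz constant
    \<open>1\<close>, and no level has been integrated out yet.\<close>
  also have "\<dots> \<le> ((2 / 3) ^ (?d - k0))\<^sup>2 * (2 + real k0)"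
    using two_point_bound[of "\<lambda>x. x" 1 \<tau>\<^sub>1 n \<tau>\<^sub>2 0] \<tau> pos
    by (simp add: exp_bounded_id divide_le_eq mult.commute)
  also have "\<dots> \<le> 2 * exp (- (2 * ln (3 / 2)) * real ?d + 2 * real k0)"
    by (rule two_thirds_power_le)
  also have "\<dots> \<le> 32 * exp (- (2 * ln (3 / 2)) * real ?d
      + 32 * (lam powr (- ((\<alpha> - 2) / \<alpha>\<^sup>2)) + 1 / \<alpha> * log_plus (1 / lam) + (\<alpha>s\<^sup>2 + \<alpha>s + 1)))"
  proof (rule mult_mono)
    have "\<alpha> \<le> \<alpha>s" "2 \<le> \<alpha>" using \<alpha> by auto
    moreover have "0 \<le> \<alpha>s\<^sup>2" by simp
    ultimately have "2 * real k0 \<le> 32 * (lam powr (- ((\<alpha> - 2) / \<alpha>\<^sup>2)) + 1 / \<alpha> * log_plus (1 / lam) + (\<alpha>s\<^sup>2 + \<alpha>s + 1))"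
      using k0 log_plus_le[of lam \<alpha> \<alpha>s] lam \<alpha>s unfolding distrib_left by linarith
    then show "exp (- (2 * ln (3 / 2)) * real ?d + 2 * real k0) \<le> exp (- (2 * ln (3 / 2)) * real ?d
      + 32 * (lam powr (- ((\<alpha> - 2) / \<alpha>\<^sup>2)) + 1 / \<alpha> * log_plus (1 / lam) + (\<alpha>s\<^sup>2 + \<alpha>s + 1)))"
      by simp
  qed auto
  finally show "\<bar>\<integral>\<Phi>. \<Phi> \<tau>\<^sub>1 * \<Phi> \<tau>\<^sub>2 \<partial>tilted_law b n (power_potential lam \<alpha>)\<bar>
      \<le> 32 * exp (- (2 * ln (3 / 2)) * real ?d
      + 32 * (lam powr (- ((\<alpha> - 2) / \<alpha>\<^sup>2)) + 1 / \<alpha> * log_plus (1 / lam) + (\<alpha>s\<^sup>2 + \<alpha>s + 1)))" .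
qed

end
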